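(* Let $\beta,\gamma_0,\gamma$ satisfy $0<\beta<\frac{\pi}{2}$, $0<\gamma_0<2\sin\left(\frac{\beta}{2}\right)$ and $\gamma=2\arcsin\left(\frac{\gamma_0}{2}\right)<\beta$. Suppose that there exists an index $i_*\in[N]$ such that $R_{i_*}^0\in B_{\gamma_0}$, and that $$\kappa>\kappa_c(\gamma)=\kappa_c(\gamma,1):=\frac{N\max_{j\in[N]}\|\Omega_j\|}{\sin\left(2\sin\frac{\gamma}{2}\right)\tilde I(\gamma)},\qquad R_i^0\in B_{\Gamma_i(\gamma)}\quad\text{for all } i\in[N],$$ where $$\Gamma_i(\gamma):=\sqrt{2+2\sqrt{1-\frac{N^2\|\Omega_i\|^2}{\kappa^2\tilde I(\gamma)^2}}}.$$ Let $\{R_i\}_{i=1}^N$ be a global solution to the Winfree matrix model on $SO(n)$ (see context). Then $$\limsup_{t\to\infty}d(I_n,R_i(t))<2\arcsin\left[\frac12\arcsin\left(\frac{\kappa_c(\gamma)}{\kappa}\sin\left(2\sin\frac{\gamma}{2}\right)\right)\right]<\gamma\quad\text{for all } i\in[N].$$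
   Context: Let $[N]=\{1,\dots,N\}$, let $I_n$ be the $n\times n$ identity matrix, and let $\mathfrak{so}(n)$ be the space of real skew-symmetric $n\times n$ matrices. On $\mathbb{R}^{n\times n}$ use $\langle A,B\rangle=\frac12\operatorname{tr}(A^TB)$ and $\|A\|=\sqrt{\langle A,A\rangle}$. Let $d$ be the geodesic (Riemannian) distance on $SO(n)$ for the metric $\langle\cdot,\cdot\rangle$ restricted to tangent spaces; if $R\in SO(n)$ has eigenvalues $e^{\pm \mathrm{i}\theta_1},\dots,e^{\pm\mathrm{i}\theta_m},1,\dots,1$ with $\theta_j\in(0,\pi]$, then $d(I_n,R)=\sqrt{\sum_j\theta_j^2}$. Put $B_r=\{R\in SO(n): d(I_n,R)<r\}$. The Winfree matrix model on $SO(n)$ is $$\dot R_i=\Omega_iR_i+\frac{\kappa}{2}\Big(\frac1N\sum_{j=1}^N I(R_j)\Big)(I_n-R_i^2),\quad t>0,\qquad R_i(0)=R_i^0\in SO(n),\quad i\in[N],$$ with $\Omega_i\in\mathfrak{so}(n)$ and $\kappa>0$. Standing assumptions on the influence function $I$: $I(R)=\tilde I(d(I_n,R))$ for a function $\tilde I:[0,\lfloor n/2\rfloor\pi]\to\mathbb{R}_{\ge0}$ that is decreasing, satisfies $\lim_{r\to0^+}\tilde I(r)=1$, is globally Lipschitz continuous, and has support $\operatorname{supp}\tilde I=[0,\beta]$ with $0<\beta<\frac{\pi}{2}$.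
   Formalization: If all Ω_j are zero, then κ_c(γ)=0, the middle bound is 0, and the strict inequality limsup d < 0 is impossible (e.g. R_i ≡ I_n); in that case only, the formal theorem proves limsup d ≤ the bound (so limsup d = 0); otherwise the strict inequality is kept. *)

theory Defs
  imports "HOL-Analysis.Analysis"
begin

definition SO :: "(real^'n^'n) set" where
  "SO = {A. rotation_matrix A}"

definition so :: "(real^'n^'n) set" where
  "so = {A. transpose A = - A}"

(* Half the Frobenius inner product; not the library norm on real^'n^'n, which is sqrt 2 times
   mat_norm. *)
definition mat_inner :: "real^'n^'n \<Rightarrow> real^'n^'n \<Rightarrow> real" where
  "mat_inner A B = trace (transpose A ** B) / 2"

definition mat_norm :: "real^'n^'n \<Rightarrow> real" where
  "mat_norm A = sqrt (mat_inner A A)"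

(* Lengths of the piecewise C1 paths in SO(n) from A to B. The predicate has_integral rather
   than the function integral is used because valid_path puts no bound on the derivative near the
   finitely many break points: a path of infinite length must contribute no length, whereas
   integral would return the default value 0. *)
definition SO_path_lengths :: "real^'n^'n \<Rightarrow> real^'n^'n \<Rightarrow> real set" where
  "SO_path_lengths A B =
     {l. \<exists>g. valid_path g \<and> path_image g \<subseteq> SO \<and> pathstart g = A \<and> pathfinish g = B \<and>
          ((\<lambda>t. mat_norm (vector_derivative g (at t))) has_integral l) {0..1}}"

definition SO_dist :: "real^'n^'n \<Rightarrow> real^'n^'n \<Rightarrow> real" where
  "SO_dist A B = Inf (SO_path_lengths A B)"

definition SO_ball :: "real \<Rightarrow> (real^'n^'n) set" where
  "SO_ball r = {R \<in> SO. SO_dist (mat 1) R < r}"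

(* Only the values of It on {0..(n div 2) * pi} are constrained; the filter at_right 0 depends
   on no others once n is at least 2, and for n at most 1 the support condition cannot hold. *)
definition influence_profile :: "nat \<Rightarrow> real \<Rightarrow> (real \<Rightarrow> real) \<Rightarrow> bool" where
  "influence_profile n \<beta> It \<longleftrightarrow>
     (let D = {0..real (n div 2) * pi} in
        (\<forall>r\<in>D. 0 \<le> It r) \<and>
        antimono_on D It \<and>
        (It \<longlongrightarrow> 1) (at_right 0) \<and>
        (\<exists>C. C-lipschitz_on D It) \<and>
        closure {r\<in>D. It r \<noteq> 0} = {0..\<beta>})"

definition influence :: "(real \<Rightarrow> real) \<Rightarrow> real^'n^'n \<Rightarrow> real" where
  "influence It R = It (SO_dist (mat 1) R)"

definition winfree_solution ::
  "nat \<Rightarrow> (nat \<Rightarrow> real^'n^'n) \<Rightarrow> real \<Rightarrow> (real \<Rightarrow> real) \<Rightarrow> (nat \<Rightarrow> real^'n^'n)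
     \<Rightarrow> (nat \<Rightarrow> real \<Rightarrow> real^'n^'n) \<Rightarrow> bool" where
  "winfree_solution N \<Omega> \<kappa> It R0 R \<longleftrightarrow>
     (\<forall>i\<in>{1..N}.
        R i 0 = R0 i \<and>
        continuous_on {0..} (R i) \<and>
        (\<forall>t\<ge>0. R i t \<in> SO) \<and>
        (\<forall>t>0. (R i has_vector_derivative
            (\<Omega> i ** R i t +
             (\<kappa> / 2 * ((1 / real N) * (\<Sum>j=1..N. influence It (R j t))))
               *\<^sub>R (mat 1 - R i t ** R i t))) (at t)))"

definition kappa_c :: "nat \<Rightarrow> (nat \<Rightarrow> real^'n^'n) \<Rightarrow> (real \<Rightarrow> real) \<Rightarrow> real \<Rightarrow> real" where
  "kappa_c N \<Omega> It \<gamma> =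
     real N * Max ((\<lambda>j. mat_norm (\<Omega> j)) ` {1..N}) / (sin (2 * sin (\<gamma> / 2)) * It \<gamma>)"

definition Gamma_radius ::
  "nat \<Rightarrow> (nat \<Rightarrow> real^'n^'n) \<Rightarrow> real \<Rightarrow> (real \<Rightarrow> real) \<Rightarrow> real \<Rightarrow> nat \<Rightarrow> real" where
  "Gamma_radius N \<Omega> \<kappa> It \<gamma> i =
     sqrt (2 + 2 * sqrt (1 - (real N)\<^sup>2 * (mat_norm (\<Omega> i))\<^sup>2 / (\<kappa>\<^sup>2 * (It \<gamma>)\<^sup>2)))"

definition limit_radius ::
  "nat \<Rightarrow> (nat \<Rightarrow> real^'n^'n) \<Rightarrow> real \<Rightarrow> (real \<Rightarrow> real) \<Rightarrow> real \<Rightarrow> real" where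
  "limit_radius N \<Omega> \<kappa> It \<gamma> =
     2 * arcsin (1 / 2 * arcsin (kappa_c N \<Omega> It \<gamma> / \<kappa> * sin (2 * sin (\<gamma> / 2))))"

end

theory Submission
  imports Defs
begin

text \<open>
  The defect \<open>n - trace R = \<parallel>1 - R\<parallel>\<^sup>2\<close>, the squared chordal distance of a rotation \<open>R\<close> from the
  identity, serves as Lyapunov function. Without normal forms, the pairing of the singular values of
  \<open>1 - R\<close> gives \<open>w\<^sup>2 \<ge> V (4 - V)\<close> for \<open>V = defect R\<close> and \<open>w\<^sup>2 = defect (R ** R)\<close>. Along a solution
  \<open>V' \<le> \<parallel>\<Omega>\<parallel> w - S w\<^sup>2\<close>, where \<open>S\<close> is the coupling strength, so \<open>V\<close> decreases between the roots
  of \<open>V (4 - V) = \<parallel>\<Omega>\<parallel>\<^sup>2 / S\<^sup>2\<close> as long as \<open>S\<close> stays bounded below. The one oscillator starting near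
  the identity provides that bound, and a first-exit argument for all oscillators at once keeps it
  there. The same inequality along a Cayley curve yields \<open>d \<le> 2 arcsin (sqrt V / 2)\<close>, which
  together with \<open>sqrt V \<le> d\<close> replaces the formula for the geodesic distance.
\<close>

subsection \<open>Matrix algebra\<close>

lemma transpose_add: "transpose (A + B) = transpose A + transpose (B::real^'n^'m)"
  by (simp add: transpose_def vec_eq_iff)

lemma transpose_diff: "transpose (A - B) = transpose A - transpose (B::real^'n^'m)"
  by (simp add: transpose_def vec_eq_iff)

lemma matrix_minus_left: "(- A) ** B = - (A ** (B::real^'p^'n))" for A :: "real^'n^'m"
  by (simp add: matrix_matrix_mult_def vec_eq_iff sum_negf)

lemma matrix_minus_right: "A ** (- B) = - (A ** (B::real^'p^'n))" for A :: "real^'n^'m"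
  by (simp add: matrix_matrix_mult_def vec_eq_iff sum_negf)

lemma matrix_diff_ldistrib: "A ** (B - C) = A ** B - A ** (C::real^'p^'n)" for A :: "real^'n^'m"
  by (simp add: matrix_matrix_mult_def vec_eq_iff sum_subtractf algebra_simps)

lemma matrix_add_rdistrib: "(A + B) ** C = A ** C + B ** (C::real^'p^'n)" for A :: "real^'n^'m"
  by (simp add: matrix_matrix_mult_def vec_eq_iff sum.distrib algebra_simps)

lemma matrix_diff_rdistrib: "(A - B) ** C = A ** C - B ** (C::real^'p^'n)" for A :: "real^'n^'m"
  by (simp add: matrix_matrix_mult_def vec_eq_iff sum_subtractf algebra_simps)

lemma matrix_scaleR_left: "(c *\<^sub>R A) ** B = c *\<^sub>R (A ** (B::real^'p^'n))" for A :: "real^'n^'m"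
  by (simp add: scalar_matrix_assoc)

lemma matrix_scaleR_right: "A ** (c *\<^sub>R B) = c *\<^sub>R (A ** (B::real^'p^'n))" for A :: "real^'n^'m"
  by (simp add: matrix_scalar_ac scalar_matrix_assoc)

lemmas matrix_distribs =
  matrix_add_ldistrib matrix_add_rdistrib matrix_diff_ldistrib matrix_diff_rdistrib
  matrix_scaleR_left matrix_scaleR_right matrix_minus_left matrix_minus_right

lemmas transpose_distribs = transpose_add transpose_diff transpose_scalar matrix_transpose_mul

lemma trace_scaleR: "trace (c *\<^sub>R A) = c * trace (A::real^'n^'n)"
  by (simp add: trace_def sum_distrib_left)

lemma trace_transpose: "trace (transpose A) = trace (A::real^'n^'n)"
  by (simp add: trace_def transpose_def)

lemmas trace_distribs = trace_add trace_sub trace_scaleR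

lemma bounded_bilinear_matrix_mult:
  "bounded_bilinear (\<lambda>(A::real^'n^'m) (B::real^'p^'n). A ** B)"
  unfolding bilinear_conv_bounded_bilinear[symmetric] bilinear_def
  by (auto intro!: linearI simp: matrix_distribs)

lemma bounded_linear_trace: "bounded_linear (trace :: real^'n^'n \<Rightarrow> real)"
  unfolding linear_conv_bounded_linear[symmetric]
  by (auto intro!: linearI simp: trace_distribs)

lemma inner_matrix_eq_trace: "A \<bullet> B = trace (transpose A ** (B::real^'n^'m))"
  unfolding inner_vec_def trace_def matrix_matrix_mult_def transpose_def
  by (simp add: sum.swap[of _ "UNIV :: 'n set"])

lemma mat_inner_eq_inner: "mat_inner A B = A \<bullet> B / 2"
  by (simp add: mat_inner_def inner_matrix_eq_trace)

lemma mat_norm_eq_norm: "mat_norm A = norm A / sqrt 2"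
  by (simp add: mat_norm_def mat_inner_eq_inner norm_eq_sqrt_inner real_sqrt_divide)

lemma mat_norm_nonneg: "0 \<le> mat_norm A"
  by (simp add: mat_norm_eq_norm)

lemma mat_norm_power2: "(mat_norm A)\<^sup>2 = (norm A)\<^sup>2 / 2"
  by (simp add: mat_norm_eq_norm power_divide)

lemma norm_transpose: "norm (transpose A) = norm (A::real^'n^'m)"
  unfolding norm_eq_sqrt_inner inner_matrix_eq_trace
  by (metis trace_mul_sym transpose_transpose)

lemma norm_matrix_columns: "(norm (A::real^'n^'m))\<^sup>2 = (\<Sum>j\<in>UNIV. (norm (A *v axis j 1))\<^sup>2)"
proof -
  have "(norm A)\<^sup>2 = (norm (transpose A))\<^sup>2" by (simp add: norm_transpose)
  also have "\<dots> = (\<Sum>j\<in>UNIV. (norm (transpose A $ j))\<^sup>2)"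
    by (simp add: norm_vec_def L2_set_def sum_nonneg)
  also have "\<dots> = (\<Sum>j\<in>UNIV. (norm (A *v axis j 1))\<^sup>2)"
    by (simp add: matrix_vector_mult_basis column_def transpose_def)
  finally show ?thesis .
qed

subsection \<open>Rotations and their defect\<close>

lemma SO_orthogonal:
  assumes "R \<in> SO"
  shows "transpose R ** R = mat 1" "R ** transpose R = mat 1" "orthogonal_matrix R" "det R = 1"
  using assms by (auto simp: SO_def rotation_matrix_def orthogonal_matrix_def)

lemma SO_I: "transpose R ** R = mat 1 \<Longrightarrow> det R = 1 \<Longrightarrow> R \<in> SO"
  by (simp add: SO_def rotation_matrix_def orthogonal_matrix)

lemma SO_mult: "A \<in> SO \<Longrightarrow> B \<in> SO \<Longrightarrow> A ** B \<in> SO"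
  by (simp add: SO_def rotation_matrix_def orthogonal_matrix_mul det_mul)

lemma SO_transpose: "A \<in> SO \<Longrightarrow> transpose A \<in> SO"
  by (simp add: SO_def rotation_matrix_def)

lemma one_in_SO: "mat 1 \<in> SO"
  by (simp add: SO_def rotation_matrix_def orthogonal_matrix_id)

lemma inner_orthogonal_vector:
  assumes "transpose R ** R = mat 1"
  shows "(R *v x) \<bullet> (R *v y) = x \<bullet> (y::real^'n)"
proof -
  have "(R *v x) \<bullet> (R *v y) = x \<bullet> (transpose R *v (R *v y))"
    by (metis dot_lmul_matrix transpose_matrix_vector vector_transpose_matrix)
  then show ?thesis by (simp only: matrix_vector_mul_assoc assms matrix_vector_mul_lid)
qed

lemma norm_orthogonal_vector:
  "transpose R ** R = mat 1 \<Longrightarrow> norm (R *v x) = norm (x::real^'n)"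
  by (simp add: norm_eq_sqrt_inner inner_orthogonal_vector)

text \<open>For a rotation with angles \<theta>_j this is the sum of the terms 4 sin^2 (\<theta>_j /
  2); the rotation of one plane by \<theta> has its squared chord 4 sin^2 (\<theta> / 2) as
  defect.\<close>

definition defect :: "real^'n^'n \<Rightarrow> real" where
  "defect A = real CARD('n) - trace A"

lemma norm_one_minus_orthogonal:
  fixes R :: "real^'n^'n"
  assumes "transpose R ** R = mat 1"
  shows "(norm (mat 1 - R))\<^sup>2 = 2 * defect R"
  unfolding power2_norm_eq_inner inner_matrix_eq_trace transpose_distribs matrix_distribs
    trace_distribs assms
  by (simp add: trace_I trace_transpose defect_def)

lemma mat_norm_one_minus:
  "R \<in> SO \<Longrightarrow> (mat_norm (mat 1 - R))\<^sup>2 = defect R"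
  using norm_one_minus_orthogonal[of R] SO_orthogonal[of R] by (simp add: mat_norm_power2)

lemma defect_nonneg: "R \<in> SO \<Longrightarrow> 0 \<le> defect R"
  by (metis mat_norm_one_minus zero_le_power2)

lemma defect_transpose: "defect (transpose R) = defect R"
  by (simp add: defect_def trace_transpose)

definition outer :: "real^'m \<Rightarrow> real^'n \<Rightarrow> real^'n^'m" where
  "outer u v = (\<chi> i j. u $ i * v $ j)"

lemma outer_vector: "outer u v *v x = (v \<bullet> x) *\<^sub>R u"
  by (simp add: outer_def matrix_vector_mult_def vec_eq_iff inner_vec_def sum_distrib_left sum_distrib_right mult_ac)

lemma mult_outer: "A ** outer u v = outer (A *v u) v"
  by (simp add: outer_def matrix_vector_mult_def matrix_matrix_mult_def vec_eq_iff sum_distrib_left sum_distrib_right mult_ac)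

lemma outer_mult_outer: "outer u v ** outer x y = (v \<bullet> x) *\<^sub>R outer u y"
  by (simp add: outer_def matrix_matrix_mult_def vec_eq_iff inner_vec_def sum_distrib_left sum_distrib_right mult_ac)

lemma transpose_outer: "transpose (outer u v) = outer v u"
  by (simp add: outer_def transpose_def vec_eq_iff)

lemma trace_outer: "trace (outer u v) = u \<bullet> v"
  by (simp add: outer_def trace_def inner_vec_def)

lemma outer_minus_left: "outer (- u) v = - outer u v"
  by (simp add: outer_def vec_eq_iff)

lemma outer_mult_transpose: "outer u v ** transpose A = outer u (A *v v)"
  by (simp add: outer_def matrix_vector_mult_def matrix_matrix_mult_def vec_eq_iff transpose_def sum_distrib_left sum_distrib_right mult_ac)

text \<open>Conjugation by an orthogonal matrix that maps a basis vector to \<open>v\<close> turns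
  the reflection into a diagonal matrix with a single entry -1.\<close>

lemma det_reflection:
  fixes v :: "real^'n"
  assumes "norm v = 1"
  shows "det (mat 1 - 2 *\<^sub>R outer v v) = -1"
proof -
  fix k :: 'n
  obtain A where A: "orthogonal_matrix A" "A *v axis k 1 = v"
    using orthogonal_matrix_exists_basis[OF assms] by metis
  let ?D = "mat 1 - 2 *\<^sub>R outer (axis k 1) (axis k 1) :: real^'n^'n"
  have eq: "mat 1 - 2 *\<^sub>R outer v v = A ** ?D ** transpose A"
    using A by (simp add: matrix_distribs mult_outer outer_mult_transpose orthogonal_matrix_def)
  have "det ?D = (\<Prod>i\<in>UNIV. ?D $ i $ i)"
    by (rule det_diagonal) (auto simp: mat_def outer_def axis_def)
  also have "\<dots> = (\<Prod>i\<in>UNIV. if i = k then -1 else 1)"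
    by (rule prod.cong) (auto simp: mat_def outer_def axis_def)
  finally have "det ?D = -1" by simp
  moreover have "det A * det A = 1"
    using det_orthogonal_matrix[OF A(1)] by auto
  ultimately show ?thesis
    unfolding eq det_mul det_transpose by simp
qed

text \<open>Composing \<open>R\<close> with the reflection \<open>H\<close> along \<open>v\<close> gives determinant \<open>-1\<close>, which forces an
  eigenvector of \<open>R H\<close> for \<open>-1\<close>; it is orthogonal to the fixed vector \<open>v\<close>.\<close>

lemma SO_second_eigenvector:
  fixes R :: "real^'n^'n"
  assumes R: "R \<in> SO" and v: "norm v = 1" "R *v v = - v"
  obtains w where "norm w = 1" "v \<bullet> w = 0" "R *v w = - w"
proof -
  define H where "H = mat 1 - 2 *\<^sub>R outer v v"
  define Q where "Q = R ** H"
  have vv: "v \<bullet> v = 1" using v by (simp add: norm_eq_1)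
  have HH: "transpose H ** H = mat 1"
    by (simp add: H_def transpose_distribs matrix_distribs transpose_outer outer_mult_outer vv scaleR_diff_right)
  have Q: "transpose Q ** Q = mat 1"
    unfolding Q_def by (metis HH R SO_orthogonal(3) orthogonal_matrix orthogonal_matrix_mul)
  have dQ: "det Q = -1"
    by (simp add: Q_def det_mul H_def det_reflection v SO_orthogonal(4)[OF R])
  have "H *v v = - v"
    by (simp add: H_def matrix_vector_mult_diff_rdistrib scaleR_matrix_vector_assoc[symmetric]
        outer_vector vv) (simp add: vec_eq_iff)
  then have Qv: "Q *v v = v"
    using v(2) by (simp add: Q_def matrix_vector_mul_assoc[symmetric] linear_neg)
  \<comment> \<open>On taking determinants, \<open>det Q = -1\<close> makes
    \<open>det (mat 1 + Q)\<close> its own negative, so -1 is an eigenvalue of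
    \<open>Q\<close>.\<close>
  have "transpose Q ** (mat 1 + Q) = transpose (mat 1 + Q)"
    by (simp add: matrix_distribs transpose_distribs Q)
  then have "det Q * det (mat 1 + Q) = det (mat 1 + Q)"
    by (metis det_mul det_transpose)
  with dQ have "det (mat 1 + Q) = 0" by simp
  then have "\<not> invertible (mat 1 + Q)"
    by (simp add: invertible_det_nz)
  then obtain u where u: "(mat 1 + Q) *v u = 0" "u \<noteq> 0"
    unfolding invertible_left_inverse matrix_left_invertible_ker by blast
  have Qu: "Q *v u = - u"
    using u by (simp add: matrix_vector_mult_add_rdistrib add_eq_0_iff)
  have "v \<bullet> u = (Q *v v) \<bullet> (Q *v u)"
    using inner_orthogonal_vector[OF Q] by simp
  then have vu: "v \<bullet> u = 0" by (simp add: Qv Qu)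
  have "R *v u = - u"
    using Qu vu by (simp add: Q_def H_def matrix_vector_mul_assoc[symmetric] algebra_simps outer_vector
        scaleR_matrix_vector_assoc[symmetric])
  then show thesis
    using u vu by (intro that[of "u /\<^sub>R norm u"]) (auto simp: matrix_vector_mult_scaleR)
qed

lemma norm_matrix_vector_power2:
  "(norm (A *v x))\<^sup>2 = (\<Sum>i\<in>UNIV. (A $ i \<bullet> x)\<^sup>2)" for A :: "real^'n^'m"
  unfolding power2_norm_eq_inner inner_vec_def[of "A *v x"]
  by (simp add: matrix_vector_mul_component power2_eq_square)

lemma bessel_two:
  fixes r v w :: "'a::real_inner"
  assumes "norm v = 1" "norm w = 1" "v \<bullet> w = 0"
  shows "(r \<bullet> v)\<^sup>2 + (r \<bullet> w)\<^sup>2 \<le> (norm r)\<^sup>2"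
proof -
  have "v \<bullet> v = 1" "w \<bullet> w = 1" using assms by (simp_all add: norm_eq_1)
  then have "(norm (r - (r \<bullet> v) *\<^sub>R v - (r \<bullet> w) *\<^sub>R w))\<^sup>2
      = (norm r)\<^sup>2 - ((r \<bullet> v)\<^sup>2 + (r \<bullet> w)\<^sup>2)"
    using assms(3) unfolding power2_norm_eq_inner
    by (simp add: inner_simps inner_commute power2_eq_square algebra_simps)
  then show ?thesis
    by (smt (verit) zero_le_power2)
qed

text \<open>Bessel's inequality for each row of \<open>A\<close>, summed over the rows.\<close>

lemma norm_matrix_two_directions:
  fixes A :: "real^'n^'m"
  assumes "norm v = 1" "norm w = 1" "v \<bullet> w = 0"
  shows "(norm (A *v v))\<^sup>2 + (norm (A *v w))\<^sup>2 \<le> (norm A)\<^sup>2"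
proof -
  have "(norm (A *v v))\<^sup>2 + (norm (A *v w))\<^sup>2 = (\<Sum>i\<in>UNIV. (A $ i \<bullet> v)\<^sup>2 + (A $ i \<bullet> w)\<^sup>2)"
    by (simp add: norm_matrix_vector_power2 sum.distrib)
  also have "\<dots> \<le> (\<Sum>i\<in>UNIV. (norm (A $ i))\<^sup>2)"
    by (intro sum_mono bessel_two assms)
  also have "\<dots> = (norm A)\<^sup>2"
    by (simp add: norm_vec_def[of A] L2_set_def sum_nonneg)
  finally show ?thesis .
qed

text \<open>The singular values of \<open>1 - R\<close> come in pairs: if \<open>v\<close> is a direction of maximal stretch, so
  is \<open>R v\<close>, because \<open>R\<close> commutes with \<open>1 - R\<close>. This gains a factor two over the Frobenius bound.\<close>

lemma norm_one_minus_SO_le: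
  fixes R :: "real^'n^'n"
  assumes R: "R \<in> SO"
  shows "(norm ((mat 1 - R) *v x))\<^sup>2 \<le> defect R * (norm x)\<^sup>2"
proof -
  define B where "B = mat 1 - R"
  note ortho = SO_orthogonal(1)[OF R]
  have nB: "(norm B)\<^sup>2 = 2 * defect R"
    unfolding B_def by (rule norm_one_minus_orthogonal[OF ortho])
  have "\<exists>v\<in>sphere 0 1. \<forall>y\<in>sphere 0 1. norm (B *v y) \<le> norm (B *v v)"
  proof (rule continuous_attains_sup)
    show "sphere (0::real^'n) 1 \<noteq> {}"
      using norm_axis_1 by (metis dist_0_norm empty_iff mem_sphere)
    show "continuous_on (sphere 0 1) (\<lambda>y. norm (B *v y))"
      by (intro continuous_on_norm linear_continuous_on matrix_vector_mul_bounded_linear)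
  qed simp
  then obtain v where v: "norm v = 1" and vmax: "\<And>y. norm y = 1 \<Longrightarrow> norm (B *v y) \<le> norm (B *v v)"
    by auto
  define l where "l = (norm (B *v v))\<^sup>2"
  have max: "(norm (B *v y))\<^sup>2 \<le> l * (norm y)\<^sup>2" for y
  proof (cases "y = 0")
    case False
    have "norm (B *v (y /\<^sub>R norm y)) \<le> norm (B *v v)"
      using False by (intro vmax) simp
    then have "norm (B *v y) / norm y \<le> norm (B *v v)"
      by (simp add: matrix_vector_mult_scaleR divide_inverse mult.commute)
    then have "norm (B *v y) \<le> norm (B *v v) * norm y"
      using False by (simp add: pos_divide_le_eq)
    then show ?thesis
      unfolding l_def by (metis norm_ge_zero power_mono power_mult_distrib)
  qed simp
  have two: "2 * l \<le> (norm B)\<^sup>2" if "norm w = 1" "v \<bullet> w = 0" "(norm (B *v w))\<^sup>2 = l" for w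
    using norm_matrix_two_directions[OF v that(1,2), of B] that(3) by (simp add: l_def)
  define u where "u = R *v v"
  have u: "norm u = 1" using norm_orthogonal_vector[OF ortho, of v] v by (simp add: u_def)
  have "B ** R = R ** B" by (simp add: B_def matrix_distribs)
  then have Bu: "B *v u = R *v (B *v v)"
    by (simp add: u_def matrix_vector_mul_assoc)
  then have lu: "(norm (B *v u))\<^sup>2 = l"
    by (simp add: norm_orthogonal_vector[OF ortho] l_def)
  \<comment> \<open>If \<open>u\<close> is not a multiple of \<open>v\<close>, orthonormalising the
    pair gives the second direction. The multiples come first: \<open>u = v\<close> means no stretch
    at all, and \<open>u = - v\<close> calls for a second eigenvector for -1.\<close>
  have "2 * l \<le> (norm B)\<^sup>2"
  proof (cases "u = v \<or> u = - v")
    case True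
    then show ?thesis
    proof
      assume "u = v"
      then have "l = 0" by (simp add: l_def B_def u_def matrix_vector_mult_diff_rdistrib)
      then show ?thesis by simp
    next
      assume "u = - v"
      then have Rv: "R *v v = - v" by (simp add: u_def)
      obtain w where w: "norm w = 1" "v \<bullet> w = 0" "R *v w = - w"
        using SO_second_eigenvector[OF R v Rv] by metis
      have double: "norm (B *v y) = 2 * norm y" if "R *v y = - y" for y
      proof -
        have "B *v y = 2 *\<^sub>R y"
          by (simp add: B_def matrix_vector_mult_diff_rdistrib that) (simp add: vec_eq_iff)
        then show ?thesis by simp
      qed
      have "(norm (B *v w))\<^sup>2 = l"
        using double[OF Rv] double[OF w(3)] w(1) v by (simp add: l_def)
      then show ?thesis using two w by blast
    qed
  next
    case False
    define c where "c = u \<bullet> v"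
    have vv: "v \<bullet> v = 1" and uu: "u \<bullet> u = 1" using u v by (simp_all add: norm_eq_1)
    \<comment> \<open>The form \<open>l * (norm y)^2 - (norm (B *v y))^2\<close> is nonnegative and
      vanishes at \<open>u\<close> and at \<open>v\<close>. Its values at \<open>u + v\<close> and
      \<open>u - v\<close> are opposite, so both vanish, and with them its polar form at
      \<open>u\<close>, \<open>v\<close>.\<close>
    have cross: "(B *v u) \<bullet> (B *v v) = l * c"
    proof -
      have e: "(norm (B *v (u + t *\<^sub>R v)))\<^sup>2 = l + l * t\<^sup>2 + 2 * t * ((B *v u) \<bullet> (B *v v))" for t
        unfolding power2_norm_eq_inner matrix_vector_right_distrib matrix_vector_mult_scaleR
        using lu l_def unfolding power2_norm_eq_inner
        by (simp add: inner_simps inner_commute power2_eq_square algebra_simps)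
      have n: "(norm (u + t *\<^sub>R v))\<^sup>2 = 1 + t\<^sup>2 + 2 * t * c" for t
        unfolding power2_norm_eq_inner
        by (simp add: inner_simps inner_commute power2_eq_square algebra_simps c_def uu vv)
      show ?thesis
        using max[of "u + 1 *\<^sub>R v"] max[of "u + (-1) *\<^sub>R v"] unfolding e n
        by (simp add: algebra_simps)
    qed
    define w where "w = u - c *\<^sub>R v"
    have nw: "(norm w)\<^sup>2 = 1 - c\<^sup>2"
      unfolding power2_norm_eq_inner
      by (simp add: w_def inner_simps inner_commute power2_eq_square algebra_simps uu vv c_def)
    have "w \<noteq> 0"
    proof
      assume "w = 0"
      then have "c\<^sup>2 = 1" "u = c *\<^sub>R v" using nw by (auto simp: w_def)
      then show False using False by (auto simp: power2_eq_1_iff)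
    qed
    have Bw: "(norm (B *v w))\<^sup>2 = l * (norm w)\<^sup>2"
      unfolding nw using cross lu l_def
      unfolding power2_norm_eq_inner w_def matrix_vector_mult_diff_distrib matrix_vector_mult_scaleR
      by (simp add: inner_simps inner_commute power2_eq_square algebra_simps)
    have "(norm (B *v (w /\<^sub>R norm w)))\<^sup>2 = l"
      using Bw \<open>w \<noteq> 0\<close> by (simp add: matrix_vector_mult_scaleR power_mult_distrib power_inverse field_simps)
    moreover have "v \<bullet> w = 0" by (simp add: w_def inner_simps vv c_def inner_commute)
    ultimately show ?thesis
      using two[of "w /\<^sub>R norm w"] \<open>w \<noteq> 0\<close> by simp
  qed
  then have "l \<le> defect R" using nB by simp
  then show ?thesis
    using max[of x] unfolding B_def[symmetric]
    by (meson mult_right_mono order_trans zero_le_power2)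
qed

text \<open>With \<open>B = mat 1 - R\<close>, the squared norm of \<open>transpose B ** B\<close>
  equals \<open>8 * defect R - 2 * defect (R ** R)\<close>; the stretch bound for
  \<open>transpose B\<close>, applied to the columns of \<open>B\<close>, makes it at most
  \<open>2 * (defect R)^2\<close>. In the quantities x_j = 4 sin^2 (\<theta>_j / 2) this says that
  the sum of the x_j^2 is at most the square of the sum of the x_j.\<close>

lemma defect_square_ge:
  fixes R :: "real^'n^'n"
  assumes R: "R \<in> SO"
  shows "defect R * (4 - defect R) \<le> defect (R ** R)"
proof -
  define B where "B = mat 1 - R"
  note o1 = SO_orthogonal(1)[OF R] and o2 = SO_orthogonal(2)[OF R]
  have nB: "(norm B)\<^sup>2 = 2 * defect R"
    unfolding B_def by (rule norm_one_minus_orthogonal[OF o1])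
  have "(norm (transpose B ** B))\<^sup>2 = (\<Sum>j\<in>UNIV. (norm (transpose B *v (B *v axis j 1)))\<^sup>2)"
    by (simp only: norm_matrix_columns matrix_vector_mul_assoc)
  also have "\<dots> \<le> (\<Sum>j\<in>UNIV. defect R * (norm (B *v axis j 1))\<^sup>2)"
    using norm_one_minus_SO_le[OF SO_transpose[OF R]]
    by (intro sum_mono) (simp only: B_def transpose_diff transpose_mat defect_transpose)
  also have "\<dots> = 2 * (defect R)\<^sup>2"
    unfolding sum_distrib_left[symmetric] norm_matrix_columns[symmetric] nB
    by (simp add: power2_eq_square)
  finally have le: "(norm (transpose B ** B))\<^sup>2 \<le> 2 * (defect R)\<^sup>2" .
  have M: "transpose B ** B = 2 *\<^sub>R mat 1 - R - transpose R"
    unfolding B_def transpose_distribs matrix_distribs o1 by (simp add: vec_eq_iff)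
  have tt: "trace (transpose R ** transpose R) = trace (R ** R)"
    by (metis matrix_transpose_mul trace_transpose)
  have "(norm (transpose B ** B))\<^sup>2 = 8 * defect R - 2 * defect (R ** R)"
    unfolding M power2_norm_eq_inner inner_matrix_eq_trace transpose_distribs matrix_distribs
      trace_distribs transpose_transpose transpose_mat o1 o2 matrix_mul_lid matrix_mul_rid
      tt trace_transpose
    by (simp add: trace_I defect_def)
  with le show ?thesis
    by (simp add: power2_eq_square algebra_simps)
qed

text \<open>\<open>mat 1 - R\<close> doubles such an \<open>x\<close>, yet stretches no vector by
  more than \<open>sqrt (defect R)\<close>, which is below 2.\<close>

lemma no_minus_one_eigenvector:
  fixes R :: "real^'n^'n"
  assumes R: "R \<in> SO" and "defect R < 4" and x: "R *v x = - x"
  shows "x = 0"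
proof (rule ccontr)
  assume "x \<noteq> 0"
  have "(mat 1 - R) *v x = 2 *\<^sub>R x"
    by (simp add: matrix_vector_mult_diff_rdistrib x) (simp add: vec_eq_iff)
  then have "4 * (norm x)\<^sup>2 \<le> defect R * (norm x)\<^sup>2"
    using norm_one_minus_SO_le[OF R, of x] by (simp add: power_mult_distrib)
  with \<open>x \<noteq> 0\<close> \<open>defect R < 4\<close> show False by simp
qed

subsection \<open>Geodesic distance from the identity\<close>

text \<open>The displacement is the integral of the velocity, whose norm is at most the integral of
  the speed.\<close>

lemma chord_le_path_length:
  assumes "l \<in> SO_path_lengths A B"
  shows "mat_norm (B - A) \<le> l"
proof -
  obtain g where g: "valid_path g" "pathstart g = A" "pathfinish g = B"
    and l: "((\<lambda>t. mat_norm (vector_derivative g (at t))) has_integral l) {0..1}"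
    using assms unfolding SO_path_lengths_def by blast
  obtain S where S: "finite S" "continuous_on {0..1} g" "g C1_differentiable_on {0..1} - S"
    using g(1) unfolding valid_path_def piecewise_C1_differentiable_on_def by blast
  have "((\<lambda>t. vector_derivative g (at t)) has_integral (g 1 - g 0)) {0..1}"
    using S by (intro fundamental_theorem_of_calculus_interior_strong[of S])
      (auto simp: C1_differentiable_on_eq vector_derivative_works[symmetric])
  then have i: "((\<lambda>t. vector_derivative g (at t)) has_integral (B - A)) {0..1}"
    using g by (simp add: pathstart_def pathfinish_def)
  have r: "((\<lambda>t. norm (vector_derivative g (at t))) has_integral (sqrt 2 * l)) {0..1}"
    using has_integral_mult_right[OF l, of "sqrt 2"] by (simp add: mat_norm_eq_norm)
  have "norm (B - A) \<le> sqrt 2 * l"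
    using integral_norm_bound_integral[of "\<lambda>t. vector_derivative g (at t)" "{0..1}"
        "\<lambda>t. norm (vector_derivative g (at t))"] i r
    by (auto simp: has_integral_iff)
  then show ?thesis by (simp add: mat_norm_eq_norm divide_le_eq mult.commute)
qed

lemma bdd_below_SO_path_lengths: "bdd_below (SO_path_lengths A B)"
  by (meson bdd_belowI chord_le_path_length mat_norm_nonneg order_trans)

lemma continuous_on_det:
  fixes g :: "real \<Rightarrow> real^'n^'n"
  assumes "continuous_on S g"
  shows "continuous_on S (\<lambda>t. det (g t))"
  unfolding det_def
  by (intro continuous_intros continuous_on_sum continuous_on_prod continuous_on_component assms)

text \<open>The determinant is continuous along the path and takes only the values 1 and -1, so it
  cannot change.\<close>

lemma orthogonal_path_in_SO:
  fixes g :: "real \<Rightarrow> real^'n^'n"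
  assumes cont: "continuous_on UNIV g" and o: "\<And>t. transpose (g t) ** g t = mat 1"
    and "g a \<in> SO"
  shows "g t \<in> SO"
proof (rule ccontr)
  assume "g t \<notin> SO"
  then have "det (g t) \<noteq> 1" using SO_I o by blast
  then have "det (g t) = -1" using det_orthogonal_matrix[of "g t"] o by (auto simp: orthogonal_matrix)
  moreover have "det (g a) = 1" using assms(3) by (rule SO_orthogonal)
  moreover have "connected (range (\<lambda>t. det (g t)))"
    by (intro connected_continuous_image continuous_on_det cont) simp
  ultimately have "0 \<in> range (\<lambda>t. det (g t))"
    using connectedD_interval[of "range (\<lambda>t. det (g t))" "-1" 1 0] by (metis rangeI zero_le_one neg_le_0_iff_le)
  then obtain s where "det (g s) = 0" by auto
  then show False using det_orthogonal_matrix[of "g s"] o by (auto simp: orthogonal_matrix)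
qed

text \<open>Differentiability on the whole line, not only on the unit interval, makes
  \<open>vector_derivative g (at t)\<close> equal to \<open>g' t\<close> at the end points
  too.\<close>

definition C1_curve :: "(real \<Rightarrow> real^'n^'n) \<Rightarrow> (real \<Rightarrow> real^'n^'n) \<Rightarrow> real^'n^'n \<Rightarrow> bool" where
  "C1_curve g g' R \<longleftrightarrow> (\<forall>t. (g has_vector_derivative g' t) (at t)) \<and> continuous_on UNIV g' \<and>
     (\<forall>t. g t \<in> SO) \<and> g 0 = mat 1 \<and> g 1 = R"

lemma C1_curve_length:
  assumes "C1_curve g g' R"
  shows "integral {0..1} (\<lambda>t. mat_norm (g' t)) \<in> SO_path_lengths (mat 1) R"
    and "(\<lambda>t. mat_norm (g' t)) integrable_on {0..1}"
proof -
  have d: "(g has_vector_derivative g' t) (at t)" for t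
    using assms by (auto simp: C1_curve_def)
  have c: "continuous_on UNIV g'"
    using assms by (auto simp: C1_curve_def)
  show intg: "(\<lambda>t. mat_norm (g' t)) integrable_on {0..1}"
    unfolding mat_norm_eq_norm
    by (intro integrable_continuous_real continuous_intros continuous_on_subset[OF c]) auto
  have "g C1_differentiable_on {0..1}"
    unfolding C1_differentiable_on_def using d c continuous_on_subset by blast
  then have "valid_path g"
    by (simp add: valid_path_def C1_differentiable_imp_piecewise)
  moreover have "((\<lambda>t. mat_norm (vector_derivative g (at t))) has_integral
      integral {0..1} (\<lambda>t. mat_norm (g' t))) {0..1}"
    unfolding vector_derivative_at[OF d] using intg by (rule integrable_integral)
  moreover have "path_image g \<subseteq> SO" "pathstart g = mat 1" "pathfinish g = R"
    using assms by (auto simp: path_image_def pathstart_def pathfinish_def C1_curve_def)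
  ultimately show "integral {0..1} (\<lambda>t. mat_norm (g' t)) \<in> SO_path_lengths (mat 1) R"
    unfolding SO_path_lengths_def by blast
qed

lemma C1_curve_mult:
  assumes "C1_curve g g' A" "C1_curve h h' B"
  shows "C1_curve (\<lambda>t. g t ** h t) (\<lambda>t. g t ** h' t + g' t ** h t) (A ** B)"
proof -
  interpret bounded_bilinear "\<lambda>(A::real^'n^'n) (B::real^'n^'n). A ** B"
    by (rule bounded_bilinear_matrix_mult)
  have "continuous_on UNIV g" "continuous_on UNIV h"
    using assms unfolding C1_curve_def
    by (meson continuous_at_imp_continuous_on has_vector_derivative_continuous)+
  then show ?thesis
    using assms unfolding C1_curve_def
    by (auto intro!: continuous_on has_vector_derivative continuous_on_add SO_mult)
qed

lemma matrix_vector_mult_minus: "(- A) *v x = - (A *v x)" for A :: "real^'n^'m"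
  by (simp add: matrix_vector_mult_def vec_eq_iff sum_negf)

lemma skew_inner_zero:
  fixes X :: "real^'n^'n"
  assumes "transpose X = - X"
  shows "x \<bullet> (X *v x) = 0"
proof -
  have "x \<bullet> (X *v x) = (transpose X *v x) \<bullet> x"
    by (metis dot_lmul_matrix transpose_matrix_vector)
  also have "\<dots> = - (x \<bullet> (X *v x))"
    unfolding assms by (simp add: matrix_vector_mult_minus inner_commute)
  finally show ?thesis by simp
qed

text \<open>Since \<open>X *v x\<close> is orthogonal to \<open>x\<close>, the matrix
  \<open>mat 1 - s *\<^sub>R X\<close> never shortens a vector; hence it is invertible, with inverse
  of operator norm at most 1. The resolvent identity \<open>res\<close> then yields Lipschitz
  continuity of \<open>Y\<close> and, through it, the derivative.\<close>

lemma skew_resolvent: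
  fixes X :: "real^'n^'n"
  assumes X: "transpose X = - X"
  obtains Y where "\<And>s. Y s ** (mat 1 - s *\<^sub>R X) = mat 1" "\<And>s. (mat 1 - s *\<^sub>R X) ** Y s = mat 1"
    "continuous_on UNIV Y" "\<And>s. (Y has_vector_derivative (Y s ** X ** Y s)) (at s)"
proof -
  have grow: "norm x \<le> norm ((mat 1 - s *\<^sub>R X) *v x)" for s x
  proof (rule power2_le_imp_le)
    have "(norm ((mat 1 - s *\<^sub>R X) *v x))\<^sup>2 = (norm x)\<^sup>2 + (norm (s *\<^sub>R (X *v x)))\<^sup>2"
      unfolding power2_norm_eq_inner matrix_vector_mult_diff_rdistrib
      using skew_inner_zero[OF X, of x]
      by (simp add: scaleR_matrix_vector_assoc[symmetric] inner_simps inner_commute)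
    then show "(norm x)\<^sup>2 \<le> (norm ((mat 1 - s *\<^sub>R X) *v x))\<^sup>2" by simp
  qed simp
  have "\<exists>B. B ** (mat 1 - s *\<^sub>R X) = mat 1" for s
    unfolding matrix_left_invertible_ker using grow by (metis norm_le_zero_iff norm_zero)
  then obtain Y where Y1: "\<And>s. Y s ** (mat 1 - s *\<^sub>R X) = mat 1" by metis
  then have Y2: "(mat 1 - s *\<^sub>R X) ** Y s = mat 1" for s
    by (simp add: matrix_left_right_inverse)
  have "norm (Y s *v x) \<le> norm x" for s x
    using grow[of "Y s *v x" s] by (simp add: matrix_vector_mul_assoc Y2)
  then have "(norm (Y s))\<^sup>2 \<le> (\<Sum>j\<in>(UNIV::'n set). 1\<^sup>2)" for s
    unfolding norm_matrix_columns by (intro sum_mono power_mono) (metis norm_axis_1, simp)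
  then have bnd: "norm (Y s) \<le> sqrt (real CARD('n))" for s
    by (intro real_le_rsqrt) simp
  have res: "Y t - Y s = (t - s) *\<^sub>R (Y t ** X ** Y s)" for s t
  proof -
    have "Y t - Y s = Y t ** ((mat 1 - s *\<^sub>R X) - (mat 1 - t *\<^sub>R X)) ** Y s"
      unfolding matrix_diff_ldistrib[of "Y t" "mat 1 - s *\<^sub>R X"] Y1
        matrix_diff_rdistrib[of "Y t ** (mat 1 - s *\<^sub>R X)"] matrix_mul_assoc[symmetric] Y2
      by simp
    also have "(mat 1 - s *\<^sub>R X) - (mat 1 - t *\<^sub>R X) = (t - s) *\<^sub>R X"
      by (simp add: scaleR_diff_left)
    finally show ?thesis by (simp add: matrix_distribs)
  qed
  interpret bounded_bilinear "\<lambda>(A::real^'n^'n) (B::real^'n^'n). A ** B"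
    by (rule bounded_bilinear_matrix_mult)
  obtain K where K: "\<And>A B. norm ((A::real^'n^'n) ** (B::real^'n^'n)) \<le> norm A * norm B * K" "0 \<le> K"
    using nonneg_bounded by blast
  define r where "r = sqrt (real CARD('n))"
  have "norm (Y t ** X ** Y s) \<le> (r * norm X * K) * r * K" for s t
  proof -
    have "norm (Y t ** X) \<le> norm (Y t) * norm X * K" by (rule K)
    also have "\<dots> \<le> r * norm X * K"
      using bnd[of t] K(2) by (intro mult_right_mono) (auto simp: r_def)
    finally have "norm (Y t ** X) \<le> r * norm X * K" .
    then have "norm (Y t ** X) * norm (Y s) * K \<le> (r * norm X * K) * r * K"
      using bnd[of s] K(2) by (intro mult_right_mono mult_mono) (auto simp: r_def)
    then show ?thesis using K(1)[of "Y t ** X" "Y s"] by linarith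
  qed
  then have "norm (Y t - Y s) \<le> \<bar>t - s\<bar> * (r * norm X * K * r * K)" for s t
    unfolding res norm_scaleR by (intro mult_left_mono) auto
  then have "(r * norm X * K * r * K)-lipschitz_on UNIV Y"
    using K(2) by (intro lipschitz_onI) (auto simp: dist_norm r_def mult.commute)
  then have cont: "continuous_on UNIV Y"
    by (rule lipschitz_on_continuous_on)
  have der: "(Y has_vector_derivative (Y s ** X ** Y s)) (at s)" for s
  proof -
    have "((\<lambda>t. Y t) \<longlongrightarrow> Y s) (at s)"
      using cont by (simp add: continuous_on_eq_continuous_at isCont_def)
    then have "((\<lambda>t. Y t ** X ** Y s) \<longlongrightarrow> Y s ** X ** Y s) (at s)"
      by (intro tendsto tendsto_const)
    then have lim: "((\<lambda>t. norm (Y t ** X ** Y s - Y s ** X ** Y s)) \<longlongrightarrow> 0) (at s)"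
      using tendsto_norm_zero LIM_zero by blast
    have eq: "norm ((Y t - Y s - (t - s) *\<^sub>R (Y s ** X ** Y s)) /\<^sub>R norm (t - s))
        \<le> norm (Y t ** X ** Y s - Y s ** X ** Y s)" for t
      unfolding res scaleR_diff_right[symmetric] norm_scaleR
      by (cases "t = s") (auto simp: mult.assoc[symmetric])
    have "((\<lambda>t. (Y t - Y s - (t - s) *\<^sub>R (Y s ** X ** Y s)) /\<^sub>R norm (t - s)) \<longlongrightarrow> 0) (at s)"
      by (rule Lim_null_comparison[OF _ lim]) (intro always_eventually allI eq)
    then show ?thesis
      unfolding has_vector_derivative_def has_derivative_at_within
      by (simp add: bounded_linear_scaleR_left)
  qed
  show thesis using that Y1 Y2 cont der by blast
qed

text \<open>\<open>X\<close> is the Cayley transform of \<open>R\<close>, which exists because -1 is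
  not an eigenvalue. The curve is (1 + s X) (1 - s X)^-1, written as
  \<open>2 *\<^sub>R Y s - mat 1\<close>. The equation for \<open>g'\<close> and the last conclusion
  serve to estimate its length.\<close>

lemma cayley_curve:
  fixes R :: "real^'n^'n"
  assumes R: "R \<in> SO" and ker: "\<And>x. R *v x = - x \<Longrightarrow> x = 0"
  obtains g g' where "C1_curve g g' R" "\<And>s. s *\<^sub>R g' s = (1/2) *\<^sub>R (g s ** g s - mat 1)"
    "\<And>s. s \<noteq> 0 \<Longrightarrow> g s = mat 1 \<Longrightarrow> R = mat 1"
proof -
  note o1 = SO_orthogonal(1)[OF R] and o2 = SO_orthogonal(2)[OF R]
  have "\<exists>W. W ** (mat 1 + R) = mat 1"
    unfolding matrix_left_invertible_ker using ker
    by (simp add: matrix_vector_mult_add_rdistrib add_eq_0_iff)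
  then obtain W where W1: "W ** (mat 1 + R) = mat 1" by blast
  then have W2: "(mat 1 + R) ** W = mat 1" by (simp add: matrix_left_right_inverse)
  define X where "X = (R - mat 1) ** W"
  have W3: "transpose W ** transpose (mat 1 + R) = mat 1"
    by (metis W2 matrix_transpose_mul transpose_mat)
  \<comment> \<open>Both sides equal \<open>transpose R - R\<close>; multiplying by
    \<open>transpose W\<close> and \<open>W\<close> turns the identity into skewness of
    \<open>X\<close>.\<close>
  have "transpose (R - mat 1) ** (mat 1 + R) = - (transpose (mat 1 + R) ** (R - mat 1))"
    unfolding transpose_distribs matrix_distribs transpose_mat o1 by simp
  then have "transpose W ** (transpose (R - mat 1) ** (mat 1 + R)) ** W
      = transpose W ** (- (transpose (mat 1 + R) ** (R - mat 1))) ** W" by simp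
  also have "\<dots> = - ((transpose W ** transpose (mat 1 + R)) ** (R - mat 1) ** W)"
    by (simp add: matrix_distribs(7,8) matrix_mul_assoc)
  also have "\<dots> = - X" by (simp add: W3 X_def)
  also have "transpose W ** (transpose (R - mat 1) ** (mat 1 + R)) ** W
      = (transpose W ** transpose (R - mat 1)) ** ((mat 1 + R) ** W)"
    by (simp add: matrix_mul_assoc)
  also have "\<dots> = transpose X" by (simp add: W2 X_def matrix_transpose_mul)
  finally have X: "transpose X = - X" .
  obtain Y where Y: "\<And>s. Y s ** (mat 1 - s *\<^sub>R X) = mat 1" "\<And>s. (mat 1 - s *\<^sub>R X) ** Y s = mat 1"
    and contY: "continuous_on UNIV Y" and derY: "\<And>s. (Y has_vector_derivative (Y s ** X ** Y s)) (at s)"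
    using skew_resolvent[OF X] by metis
  define g where "g s = 2 *\<^sub>R Y s - mat 1" for s
  define g' where "g' s = 2 *\<^sub>R (Y s ** X ** Y s)" for s
  interpret bounded_bilinear "\<lambda>(A::real^'n^'n) (B::real^'n^'n). A ** B"
    by (rule bounded_bilinear_matrix_mult)
  have derg: "(g has_vector_derivative g' s) (at s)" for s
    unfolding g_def g'_def using derY[of s] by (auto intro!: derivative_eq_intros)
  have contg': "continuous_on UNIV g'"
    unfolding g'_def by (intro continuous_on_scaleR continuous_on continuous_on_const contY)
  have Y0: "Y 0 = mat 1" using Y(1)[of 0] by simp
  have g0: "g 0 = mat 1" by (simp add: g_def Y0) (simp add: vec_eq_iff)
  \<comment> \<open>This is orthogonality of \<open>2 *\<^sub>R Y s - mat 1\<close> in disguise. It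
    comes from multiplying the symmetric part of \<open>mat 1 - s *\<^sub>R X\<close>, which is the
    identity, by \<open>transpose (Y s)\<close> and \<open>Y s\<close>.\<close>
  have sum: "transpose (Y s) + Y s = 2 *\<^sub>R (transpose (Y s) ** Y s)" for s
  proof -
    have "transpose (Y s) ** transpose (mat 1 - s *\<^sub>R X) = mat 1"
      by (metis Y(2) matrix_transpose_mul transpose_mat)
    then have "transpose (Y s) ** (transpose (mat 1 - s *\<^sub>R X) + (mat 1 - s *\<^sub>R X)) ** Y s
       = transpose (Y s) + Y s"
      unfolding matrix_add_ldistrib matrix_add_rdistrib
      by (metis Y(2) matrix_mul_assoc matrix_mul_lid matrix_mul_rid add.commute)
    moreover have "transpose (mat 1 - s *\<^sub>R X) + (mat 1 - s *\<^sub>R X) = 2 *\<^sub>R mat 1"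
      unfolding transpose_distribs X transpose_mat by (simp add: vec_eq_iff)
    ultimately show ?thesis by (simp add: matrix_distribs)
  qed
  have orth: "transpose (g s) ** g s = mat 1" for s
  proof -
    have "transpose (g s) ** g s
        = 2 *\<^sub>R (2 *\<^sub>R (transpose (Y s) ** Y s)) - 2 *\<^sub>R (transpose (Y s) + Y s) + mat 1"
      unfolding g_def transpose_distribs matrix_distribs transpose_mat
      by (simp add: scaleR_add_right scaleR_diff_right)
    then show ?thesis unfolding sum by simp
  qed
  have contg: "continuous_on UNIV g" unfolding g_def by (intro continuous_intros contY)
  have gSO: "g s \<in> SO" for s
    by (rule orthogonal_path_in_SO[OF contg orth, of 0]) (simp add: g0 one_in_SO)
  have XR: "X ** (mat 1 + R) = R - mat 1"
    by (simp add: X_def matrix_mul_assoc[symmetric] W1)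
  have g1: "g 1 = R"
  proof -
    have "(mat 1 - 1 *\<^sub>R X) ** (mat 1 + R) = 2 *\<^sub>R mat 1"
      unfolding matrix_diff_rdistrib scaleR_one XR by (simp add: vec_eq_iff)
    then have "Y 1 ** (mat 1 - 1 *\<^sub>R X) ** (mat 1 + R) = 2 *\<^sub>R Y 1"
      unfolding matrix_mul_assoc[symmetric] by (simp only: matrix_scaleR_right matrix_mul_rid)
    then have "2 *\<^sub>R Y 1 = mat 1 + R" unfolding Y by simp
    then show ?thesis by (simp add: g_def)
  qed
  have flow: "s *\<^sub>R g' s = (1/2) *\<^sub>R (g s ** g s - mat 1)" for s
  proof -
    have "s *\<^sub>R (Y s ** X ** Y s) = Y s ** (mat 1 - (mat 1 - s *\<^sub>R X)) ** Y s"
      by (simp add: matrix_distribs)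
    also have "\<dots> = Y s ** Y s - Y s"
      unfolding matrix_diff_ldistrib[of "Y s" "mat 1"] matrix_diff_rdistrib[of _ _ "Y s"] Y by simp
    finally have e: "s *\<^sub>R (Y s ** X ** Y s) = Y s ** Y s - Y s" .
    have "s *\<^sub>R g' s = 2 *\<^sub>R (s *\<^sub>R (Y s ** X ** Y s))" by (simp add: g'_def mult.commute)
    then show ?thesis
      unfolding e g_def matrix_distribs matrix_mul_lid matrix_mul_rid by (simp add: vec_eq_iff)
  qed
  have "R = mat 1" if "s \<noteq> 0" "g s = mat 1" for s
  proof -
    have "2 *\<^sub>R Y s = 2 *\<^sub>R mat 1" using that(2) by (simp add: g_def vec_eq_iff diff_eq_eq)
    then have "Y s = mat 1" by simp
    then have "s *\<^sub>R X = 0" using Y(1)[of s] by simp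
    then have "X = 0" using that by simp
    then show ?thesis using XR by simp
  qed
  then show thesis
    using that[of g g'] derg contg' gSO g0 g1 flow by (auto simp: C1_curve_def)
qed

lemma SO_dist_self: "SO_dist (mat 1) (mat 1 :: real^'n^'n) \<le> 0"
proof -
  have "C1_curve (\<lambda>_. mat 1) (\<lambda>_. 0) (mat 1 :: real^'n^'n)"
    by (auto simp: C1_curve_def one_in_SO)
  from C1_curve_length(1)[OF this] have "0 \<in> SO_path_lengths (mat 1) (mat 1 :: real^'n^'n)"
    by (simp add: mat_norm_eq_norm)
  then show ?thesis
    unfolding SO_dist_def by (intro cInf_lower bdd_below_SO_path_lengths)
qed

lemma defect_pos:
  assumes "R \<in> SO" "R \<noteq> mat 1"
  shows "0 < defect R"
  using norm_one_minus_orthogonal[of R] SO_orthogonal(1)[of R] assms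
  by (metis eq_iff_diff_eq_0 mult_pos_pos zero_less_mult_pos zero_less_norm_iff zero_less_numeral zero_less_power)

text \<open>The Cayley curve \<open>g s = (1 + s X) (1 - s X)\<inverse>\<close> is a reparametrised gradient flow of the
  defect, so its speed is bounded by the derivative of \<open>2 arcsin (sqrt (defect (g s)) / 2)\<close>.\<close>

lemma SO_dist_le_arcsin:
  fixes R :: "real^'n^'n"
  assumes R: "R \<in> SO" and lt: "defect R < 4"
  shows "SO_dist (mat 1) R \<le> 2 * arcsin (sqrt (defect R) / 2)"
proof (cases "R = mat 1")
  case True
  then show ?thesis using SO_dist_self by (simp add: defect_def trace_I)
next
  case False
  obtain g g' where g: "C1_curve g g' R" and flow: "\<And>s. s *\<^sub>R g' s = (1/2) *\<^sub>R (g s ** g s - mat 1)"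
    and nz: "\<And>s. s \<noteq> 0 \<Longrightarrow> g s \<noteq> mat 1"
    using cayley_curve[OF R no_minus_one_eigenvector[OF R lt]] False by metis
  have gSO: "g s \<in> SO" and der: "(g has_vector_derivative g' s) (at s)" for s
    using g by (auto simp: C1_curve_def)
  have contg: "continuous_on UNIV g"
    by (meson der continuous_at_imp_continuous_on has_vector_derivative_continuous)
  define V where "V s = defect (g s)" for s
  define D where "D s = defect (g s ** g s)" for s
  have contV: "continuous_on S V" for S
    unfolding V_def defect_def
    by (intro continuous_intros bounded_linear.continuous_on[OF bounded_linear_trace]
        continuous_on_subset[OF contg]) simp
  have derV: "(V has_real_derivative D s / (2 * s)) (at s)" if "0 < s" for s
  proof -
    have "(V has_real_derivative - trace (g' s)) (at s)"
      unfolding V_def defect_def has_real_derivative_iff_has_vector_derivative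
      by (auto intro!: derivative_eq_intros bounded_linear.has_vector_derivative[OF bounded_linear_trace der])
    moreover have "s * trace (g' s) = - D s / 2"
      unfolding trace_scaleR[symmetric] flow by (simp add: trace_distribs D_def defect_def trace_I)
    then have "- trace (g' s) = D s / (2 * s)" using that by (simp add: field_simps)
    ultimately show ?thesis by simp
  qed
  have D0: "0 \<le> D s" for s unfolding D_def by (intro defect_nonneg SO_mult gSO)
  have Vpos: "0 < V s" if "0 < s" for s
    unfolding V_def using that nz by (intro defect_pos gSO) auto
  have Vlt: "V s < 4" if "0 < s" "s \<le> 1" for s
  proof -
    have "V s \<le> V 1"
    proof (rule DERIV_nonneg_imp_nondecreasing[OF that(2)])
      show "\<exists>y. (V has_real_derivative y) (at x) \<and> 0 \<le> y" if "s \<le> x" "x \<le> 1" for x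
        using derV[of x] D0[of x] \<open>0 < s\<close> that by (intro exI[of _ "D x / (2 * x)"]) auto
    qed
    then show ?thesis using lt g by (simp add: V_def C1_curve_def)
  qed
  have DV: "V s * (4 - V s) \<le> D s" for s
    unfolding V_def D_def by (intro defect_square_ge gSO)
  define h where "h s = 2 * arcsin (sqrt (V s) / 2)" for s
  \<comment> \<open>At 0 the square root obstructs the chain rule, and only continuity of
    \<open>h\<close> is needed there. The value of \<open>h'\<close> at 0 is free and is chosen so
    that the comparison with the speed is trivial.\<close>
  define h' where "h' s = (if 0 < s then D s / (2 * s) / sqrt (V s * (4 - V s)) else mat_norm (g' s))" for s
  have speed: "mat_norm (g' s) = sqrt (D s) / (2 * s)" if "0 < s" for s
  proof -
    have "g' s = - ((1 / (2 * s)) *\<^sub>R (mat 1 - g s ** g s))"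
      using arg_cong[OF flow[of s], of "\<lambda>A. (1/s) *\<^sub>R A"] that
      by (simp add: scaleR_minus_right[symmetric] del: scaleR_minus_right)
    then have "mat_norm (g' s) = (1 / (2 * s)) * mat_norm (mat 1 - g s ** g s)"
      using that by (simp add: mat_norm_eq_norm)
    also have "mat_norm (mat 1 - g s ** g s) = sqrt (D s)"
      unfolding D_def mat_norm_one_minus[OF SO_mult[OF gSO gSO], symmetric]
      by (simp add: mat_norm_nonneg)
    finally show ?thesis by simp
  qed
  \<comment> \<open>For positive \<open>s\<close> the quotient of \<open>h' s\<close> by the speed
    is \<open>sqrt (D s) / sqrt (V s * (4 - V s))\<close> when the speed is nonzero, and
    \<open>DV\<close> makes this at least 1.\<close>
  have le: "mat_norm (g' s) \<le> h' s" if s: "s \<in> {0..1}" for s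
  proof (cases "0 < s")
    case True
    have p: "0 < V s * (4 - V s)" using Vpos[of s] Vlt[of s] True s by simp
    have "sqrt (D s) * sqrt (V s * (4 - V s)) \<le> sqrt (D s) * sqrt (D s)"
      using DV[of s] D0[of s] by (intro mult_left_mono) auto
    then have "sqrt (D s) * sqrt (V s * (4 - V s)) \<le> D s" using D0[of s] by simp
    then have "sqrt (D s) \<le> D s / sqrt (V s * (4 - V s))"
      using p by (simp add: pos_le_divide_eq)
    then have "sqrt (D s) / (2 * s) \<le> D s / sqrt (V s * (4 - V s)) / (2 * s)"
      using True by (intro divide_right_mono) auto
    then show ?thesis using True by (simp add: h'_def speed mult.commute)
  qed (simp add: h'_def)
  have hi: "(h' has_integral (h 1 - h 0)) {0..1}"
  proof (rule fundamental_theorem_of_calculus_interior)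
    have "V s \<le> 4" if "s \<in> {0..1}" for s
      using Vlt[of s] that g by (cases "s = 0") (auto simp: V_def C1_curve_def defect_def trace_I)
    then have "sqrt (V s) / 2 \<le> 1" if "s \<in> {0..1}" for s
      using that real_sqrt_le_mono[of "V s" 4] by simp
    moreover have "0 \<le> sqrt (V s) / 2" for s by (simp add: V_def defect_nonneg gSO)
    then have "-1 \<le> sqrt (V s) / 2" for s by (meson neg_le_0_iff_le order_trans zero_le_one)
    ultimately show "continuous_on {0..1} h"
      unfolding h_def by (intro continuous_intros contV) simp_all
    show "(h has_vector_derivative h' s) (at s)" if s: "s \<in> {0<..<1}" for s
    proof -
      have v: "0 < V s" "V s < 4" using Vpos[of s] Vlt[of s] s by auto
      then have r: "sqrt (V s) / 2 < 1" using real_sqrt_less_mono[OF v(2)] by simp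
      have r': "-1 < sqrt (V s) / 2" using real_sqrt_gt_zero[OF v(1)] by linarith
      have "((\<lambda>s. sqrt (V s)) has_real_derivative inverse (sqrt (V s)) / 2 * (D s / (2 * s))) (at s)"
        by (rule DERIV_chain2[where f = sqrt and g = V and x = s, OF DERIV_real_sqrt[OF v(1)] derV])
          (use s in simp)
      then have "((\<lambda>s. sqrt (V s) / 2) has_real_derivative inverse (sqrt (V s)) / 2 * (D s / (2 * s)) / 2) (at s)"
        by (rule DERIV_cdivide)
      then have "((\<lambda>s. arcsin (sqrt (V s) / 2)) has_real_derivative
          inverse (sqrt (1 - (sqrt (V s) / 2)\<^sup>2)) * (inverse (sqrt (V s)) / 2 * (D s / (2 * s)) / 2)) (at s)"
        by (rule DERIV_chain2[where f = arcsin and g = "\<lambda>s. sqrt (V s) / 2" and x = s, OF DERIV_arcsin[OF r' r]])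
      then have "(h has_real_derivative 2 * (inverse (sqrt (1 - (sqrt (V s) / 2)\<^sup>2)) *
          (inverse (sqrt (V s)) / 2 * (D s / (2 * s)) / 2))) (at s)"
        unfolding h_def by (rule DERIV_cmult)
      also have "1 - (sqrt (V s) / 2)\<^sup>2 = (4 - V s) / 4"
        using v by (simp add: power_divide field_simps)
      also have "2 * (inverse (sqrt ((4 - V s) / 4)) * (inverse (sqrt (V s)) / 2 * (D s / (2 * s)) / 2)) = h' s"
        using s v by (simp add: h'_def real_sqrt_divide real_sqrt_mult divide_simps)
      finally show ?thesis
        by (simp add: has_real_derivative_iff_has_vector_derivative)
    qed
  qed simp
  have "integral {0..1} (\<lambda>t. mat_norm (g' t)) \<le> h 1 - h 0"
    by (rule has_integral_le[OF integrable_integral[OF C1_curve_length(2)[OF g]] hi le])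
  moreover have "SO_dist (mat 1) R \<le> integral {0..1} (\<lambda>t. mat_norm (g' t))"
    unfolding SO_dist_def
    by (intro cInf_lower bdd_below_SO_path_lengths C1_curve_length(1)[OF g])
  moreover have "h 0 = 0" "h 1 = 2 * arcsin (sqrt (defect R) / 2)"
    using g by (auto simp: h_def V_def C1_curve_def defect_def trace_I)
  ultimately show ?thesis by simp
qed

text \<open>A rotation without eigenvalue \<open>-1\<close> is joined to the identity by a Cayley curve. Otherwise
  composing with a half turn in a plane of the \<open>-1\<close>-eigenspace lowers the defect by 4.\<close>

lemma C1_curve_exists:
  fixes R :: "real^'n^'n"
  assumes "R \<in> SO"
  shows "\<exists>g g'. C1_curve g g' R"
proof -
  \<comment> \<open>Induction on a bound for the defect in multiples of 4; the base case is void
    because the defect is nonnegative.\<close>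
  have "\<exists>g g'. C1_curve g g' R" if "R \<in> SO" "defect R < 4 * real k" for k and R :: "real^'n^'n"
    using that
  proof (induction k arbitrary: R)
    case 0
    then show ?case using defect_nonneg[of R] by simp
  next
    case (Suc k)
    note R = Suc.prems(1)
    show ?case
    proof (cases "\<forall>x. R *v x = - x \<longrightarrow> x = 0")
      case True
      then show ?thesis using cayley_curve[OF R] by metis
    next
      case False
      then obtain x where x: "R *v x = - x" "x \<noteq> 0" by blast
      define v where "v = x /\<^sub>R norm x"
      have v: "norm v = 1" "R *v v = - v"
        using x by (simp_all add: v_def matrix_vector_mult_scaleR)
      obtain w where w: "norm w = 1" "v \<bullet> w = 0" "R *v w = - w"
        using SO_second_eigenvector[OF R v] by metis
      have ip: "v \<bullet> v = 1" "w \<bullet> w = 1" "v \<bullet> w = 0" "w \<bullet> v = 0"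
        using v w by (simp_all add: norm_eq_1 inner_commute)
      define P where "P = outer v v + outer w w"
      define X where "X = outer w v - outer v w"
      have alg: "P ** P = P" "P ** X = X" "X ** P = X" "X ** X = - P" "transpose P = P" "transpose X = - X"
        by (simp_all add: P_def X_def matrix_distribs transpose_distribs outer_mult_outer ip transpose_outer)
      \<comment> \<open>Rotation by the angle \<open>pi * t\<close> in the plane of \<open>v\<close>
        and \<open>w\<close>, with \<open>P\<close> the projection onto the plane and
        \<open>X\<close> the quarter turn in it.\<close>
      define g where "g t = mat 1 + (cos (pi * t) - 1) *\<^sub>R P + sin (pi * t) *\<^sub>R X" for t
      define g' where "g' t = (- (sin (pi * t) * pi)) *\<^sub>R P + (cos (pi * t) * pi) *\<^sub>R X" for t
      have derg: "(g has_vector_derivative g' t) (at t)" for t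
        unfolding g_def g'_def has_vector_derivative_def
        by (auto intro!: derivative_eq_intros ext simp: algebra_simps)
      have contg: "continuous_on UNIV g" and contg': "continuous_on UNIV g'"
        unfolding g_def g'_def by (intro continuous_intros)+
      have orth: "transpose (g t) ** g t = mat 1" for t
      proof -
        let ?c = "cos (pi * t)" and ?s = "sin (pi * t)"
        have trig: "?c * (?c * p) + ?s * (?s * p) = p" for p
          using sin_cos_squared_add[of "pi * t"] unfolding power2_eq_square
          by (metis add.commute distrib_right mult.assoc mult_1)
        show ?thesis
          unfolding g_def transpose_distribs matrix_distribs transpose_mat alg
          by (simp add: vec_eq_iff algebra_simps trig)
      qed
      have g0: "g 0 = mat 1" by (simp add: g_def)
      have gSO: "g t \<in> SO" for t
        by (rule orthogonal_path_in_SO[OF contg orth, of 0]) (simp add: g0 one_in_SO)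
      define G where "G = g 1"
      have G: "G = mat 1 - 2 *\<^sub>R P" by (simp add: G_def g_def vec_eq_iff)
      have cG: "C1_curve g g' G"
        using derg contg' gSO g0 by (simp add: C1_curve_def G_def)
      \<comment> \<open>\<open>R\<close> acts as -1 on the plane, so composing with the half turn
        \<open>G\<close> makes the plane fixed and raises the trace by 4.\<close>
      have "R ** P = - P"
        unfolding P_def matrix_distribs mult_outer v w outer_minus_left by simp
      then have RG: "R ** G = R + 2 *\<^sub>R P"
        unfolding G matrix_distribs by simp
      have "defect (R ** G) < 4 * real k"
        using Suc.prems(2) unfolding RG defect_def trace_distribs
        by (simp add: P_def trace_distribs trace_outer ip)
      moreover have "R ** G \<in> SO" using R gSO by (simp add: G_def SO_mult)
      ultimately obtain h h' where h: "C1_curve h h' (R ** G)" using Suc.IH by blast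
      have "G ** G = mat 1"
        unfolding G matrix_distribs alg by (simp add: vec_eq_iff)
      then have "R ** G ** G = R" by (simp add: matrix_mul_assoc[symmetric])
      then show ?thesis using C1_curve_mult[OF h cG] by metis
    qed
  qed
  moreover obtain k where "defect R < 4 * real k"
    using reals_Archimedean2[of "defect R / 4"] by (auto simp: field_simps)
  ultimately show ?thesis using assms by blast
qed

text \<open>The chord bounds every path length from below. Existence of a path is needed as well,
  since the infimum of an empty set of reals carries no information.\<close>

lemma sqrt_defect_le_SO_dist:
  assumes "R \<in> SO"
  shows "sqrt (defect R) \<le> SO_dist (mat 1) R"
proof -
  have "SO_path_lengths (mat 1) R \<noteq> {}"
    using C1_curve_exists[OF assms] C1_curve_length(1) by blast
  moreover have "sqrt (defect R) \<le> l" if "l \<in> SO_path_lengths (mat 1) R" for l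
    using chord_le_path_length[OF that] mat_norm_one_minus[OF assms, symmetric]
    by (simp add: mat_norm_eq_norm norm_minus_commute)
  ultimately show ?thesis unfolding SO_dist_def by (rule cInf_greatest)
qed

subsection \<open>Barriers and the decay of the defect\<close>

text \<open>Halving the angle produces the factor \<open>cos (x / 2) < 1\<close>, which makes the
  weak bound at \<open>x / 2\<close> strict at \<open>x\<close>.\<close>

lemma sin_less_self:
  fixes x :: real
  assumes "0 < x" "x \<le> pi"
  shows "sin x < x"
proof -
  have "sin x = 2 * sin (x / 2) * cos (x / 2)"
    using sin_double[of "x / 2"] by simp
  also have "\<dots> \<le> x * cos (x / 2)"
    using sin_x_le_x[of "x / 2"] cos_ge_zero[of "x / 2"] assms
    by (intro mult_right_mono) auto
  also have "\<dots> < x"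
    using cos_monotone_0_pi[of 0 "x / 2"] assms by simp
  finally show ?thesis .
qed

text \<open>At the first time some \<open>V j\<close> reaches its level, all components are still at
  or below theirs, so \<open>inward\<close> applies. A negative derivative there would put
  \<open>V j\<close> above its level just before. That \<open>inward\<close> may assume all bounds
  at once is what handles the coupling of the oscillators.\<close>

lemma first_exit_barrier:
  fixes V :: "'i \<Rightarrow> real \<Rightarrow> real"
  assumes fin: "finite I"
    and cont: "\<And>i. i \<in> I \<Longrightarrow> continuous_on {0..} (V i)"
    and init: "\<And>i. i \<in> I \<Longrightarrow> V i 0 < c i"
    and inward: "\<And>i t. i \<in> I \<Longrightarrow> 0 < t \<Longrightarrow> (\<forall>j\<in>I. V j t \<le> c j) \<Longrightarrow> V i t = c i
      \<Longrightarrow> \<exists>y<0. (V i has_real_derivative y) (at t)"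
    and "i \<in> I" "0 \<le> t"
  shows "V i t < c i"
proof (rule ccontr)
  assume "\<not> V i t < c i"
  define B where "B = (\<Union>j\<in>I. {0..} \<inter> V j -` {c j..})"
  have "closed B"
    unfolding B_def
    by (intro closed_UN fin ballI continuous_closed_preimage cont) auto
  moreover have "t \<in> B" using \<open>\<not> V i t < c i\<close> \<open>i \<in> I\<close> \<open>0 \<le> t\<close> by (force simp: B_def)
  moreover have bdd: "bdd_below B" by (intro bdd_belowI[of _ 0]) (auto simp: B_def)
  ultimately have TB: "Inf B \<in> B" by (intro closed_contains_Inf) auto
  define T where "T = Inf B"
  have before: "V j s < c j" if "j \<in> I" "0 \<le> s" "s < T" for j s
  proof (rule ccontr)
    assume "\<not> V j s < c j"
    then have "s \<in> B" using that by (force simp: B_def)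
    then have "T \<le> s" unfolding T_def using bdd by (rule cInf_lower)
    then show False using that by simp
  qed
  obtain j where j: "j \<in> I" "c j \<le> V j T" and "0 \<le> T"
    using TB by (auto simp: T_def B_def)
  then have "0 < T" using init[OF j(1)] by (cases "T = 0") auto
  have "V l T \<le> c l" if "l \<in> I" for l
  proof (rule tendsto_upperbound)
    have "isCont (V l) T"
      using continuous_on_interior[OF cont[OF that]] \<open>0 < T\<close> by simp
    then show "(V l \<longlongrightarrow> V l T) (at_left T)"
      by (simp add: isCont_def filterlim_at_split)
    show "\<forall>\<^sub>F s in at_left T. V l s \<le> c l"
      using eventually_at_left_real[OF \<open>0 < T\<close>]
      by eventually_elim (use before[OF that] in \<open>simp add: less_imp_le\<close>)
  qed simp
  then have "\<forall>l\<in>I. V l T \<le> c l" "V j T = c j" using j by (simp_all add: antisym)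
  then obtain y where y: "y < 0" "(V j has_real_derivative y) (at T)"
    using inward[OF j(1) \<open>0 < T\<close>] by blast
  then obtain d where d: "0 < d" "\<And>h. 0 < h \<Longrightarrow> h < d \<Longrightarrow> V j T < V j (T - h)"
    using DERIV_neg_dec_left by metis
  define h where "h = min (d / 2) T"
  have "V j T < V j (T - h)" using d \<open>0 < T\<close> by (intro d(2)) (auto simp: h_def)
  moreover have "V j (T - h) < c j"
    using j(1) \<open>0 < T\<close> d(1) by (intro before) (auto simp: h_def)
  ultimately show False using j(2) by simp
qed

text \<open>Above \<open>L\<close> the function loses at least \<open>e\<close> per unit of time, so
  being nonnegative it must fall below \<open>L\<close> once; the barrier argument with a single
  index then keeps it there.\<close>

lemma eventually_below_level:
  fixes f :: "real \<Rightarrow> real"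
  assumes cont: "continuous_on {0..} f" and nonneg: "\<And>t. 0 \<le> t \<Longrightarrow> 0 \<le> f t" and "0 < e"
    and decay: "\<And>t. 0 < t \<Longrightarrow> L \<le> f t \<Longrightarrow> \<exists>y\<le>-e. (f has_real_derivative y) (at t)"
  shows "\<forall>\<^sub>F t in at_top. f t < L"
proof -
  have "\<exists>t0>0. f t0 < L"
  proof (rule ccontr)
    assume "\<not> (\<exists>t0>0. f t0 < L)"
    then have above: "L \<le> f t" if "0 < t" for t using that by force
    \<comment> \<open>Chosen so that decay at rate \<open>e\<close> from time 1 on would bring
      \<open>f T\<close> down to at most \<open>- e\<close>.\<close>
    define T where "T = 2 + f 1 / e"
    have "1 \<le> T" using nonneg[of 1] \<open>0 < e\<close> by (simp add: T_def)
    then have "f T + e * T \<le> f 1 + e * 1"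
    proof (rule DERIV_nonpos_imp_nonincreasing)
      fix x :: real assume "1 \<le> x"
      then obtain y where y: "y \<le> - e" "(f has_real_derivative y) (at x)"
        using decay[of x] above[of x] by auto
      then have "((\<lambda>t. f t + e * t) has_real_derivative y + e) (at x)"
        by (auto intro!: derivative_eq_intros)
      then show "\<exists>y. ((\<lambda>t. f t + e * t) has_real_derivative y) (at x) \<and> y \<le> 0"
        using y(1) by (intro exI[of _ "y + e"]) auto
    qed
    moreover have "e * T = 2 * e + f 1" using \<open>0 < e\<close> by (simp add: T_def field_simps)
    moreover have "0 \<le> f T" using nonneg \<open>1 \<le> T\<close> by simp
    ultimately show False using \<open>0 < e\<close> by simp
  qed
  then obtain t0 where t0: "0 < t0" "f t0 < L" by blast
  have "f (s + t0) < L" if "0 \<le> s" for s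
  proof (rule first_exit_barrier[of "{()}" "\<lambda>_ s. f (s + t0)" "\<lambda>_. L"])
    show "continuous_on {0..} (\<lambda>s. f (s + t0))"
      using t0 by (intro continuous_on_compose2[OF cont]) (auto intro!: continuous_intros)
    show "\<exists>y<0. ((\<lambda>s. f (s + t0)) has_real_derivative y) (at t)"
      if t: "0 < t" "f (t + t0) = L" for t
    proof -
      obtain y where "y \<le> - e" "(f has_real_derivative y) (at (t + t0))"
        using decay[of "t + t0"] t t0 by auto
      then show ?thesis using \<open>0 < e\<close> by (auto simp: DERIV_shift intro!: exI[of _ y])
    qed
  qed (use t0 that in auto)
  from this[of "t - t0" for t] have "f t < L" if "t0 \<le> t" for t using that by simp
  then show ?thesis by (auto simp: eventually_at_top_linorder)
qed

text \<open>By concavity \<open>x * (4 - x)\<close> lies above its secant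
  \<open>(4 - l - c) * x + l * c\<close>, which is smallest at an end point.\<close>

lemma quadratic_lower_bound:
  fixes x :: real
  assumes "l \<le> x" "x \<le> c" "m \<le> l * (4 - l)" "m \<le> c * (4 - c)"
  shows "m \<le> x * (4 - x)"
proof -
  have "0 \<le> (x - l) * (c - x)" using assms by simp
  then have e: "(4 - l - c) * x + l * c \<le> x * (4 - x)" by (simp add: algebra_simps)
  show ?thesis
  proof (cases "0 \<le> 4 - l - c")
    case True
    then have "(4 - l - c) * l \<le> (4 - l - c) * x" using assms(1) by (rule mult_left_mono[rotated])
    then show ?thesis using e assms(3) by (simp add: algebra_simps)
  next
    case False
    then have "(4 - l - c) * c \<le> (4 - l - c) * x" using assms(2) by (intro mult_left_mono_neg) auto
    then show ?thesis using e assms(4) by (simp add: algebra_simps)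
  qed
qed

text \<open>Double angle formula: for the squared chord of an angle \<open>m\<close>, the lower
  bound from \<open>defect_square_ge\<close> becomes \<open>4 * (sin m)^2\<close>.\<close>

lemma chord_quadratic_sin: "(2 * sin (m / 2))\<^sup>2 * (4 - (2 * sin (m / 2))\<^sup>2) = 4 * (sin m)\<^sup>2" for m :: real
proof -
  have "sin m = 2 * sin (m / 2) * cos (m / 2)" using sin_double[of "m / 2"] by simp
  moreover have "(2 * sin (m / 2))\<^sup>2 = 4 * (sin (m / 2))\<^sup>2" by (simp add: power_mult_distrib)
  then have "4 - (2 * sin (m / 2))\<^sup>2 = 4 * (cos (m / 2))\<^sup>2"
    using sin_cos_squared_add[of "m / 2"] by linarith
  ultimately show ?thesis by (simp only: power_mult_distrib mult_ac)
qed

text \<open>A skew \<open>W\<close> pairs only with the skew part of \<open>R\<close>, and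
  \<open>norm (R - transpose R)\<close> is determined by the defect of \<open>R ** R\<close>; the
  rest is Cauchy-Schwarz.\<close>

lemma trace_skew_rotation_le:
  fixes W R :: "real^'n^'n"
  assumes W: "W \<in> so" and R: "R \<in> SO"
  shows "- trace (W ** R) \<le> mat_norm W * sqrt (defect (R ** R))"
proof -
  have Wt: "transpose W = - W" using W by (simp add: so_def)
  have 1: "W \<bullet> R = - trace (W ** R)"
    unfolding inner_matrix_eq_trace Wt matrix_minus_left by (simp add: trace_def sum_negf)
  have "W \<bullet> transpose R = trace (transpose (R ** W))"
    unfolding inner_matrix_eq_trace matrix_transpose_mul ..
  also have "\<dots> = trace (W ** R)" by (metis trace_transpose trace_mul_sym)
  finally have 2: "W \<bullet> (R - transpose R) = - 2 * trace (W ** R)"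
    using 1 by (simp add: inner_diff_right)
  have "trace (transpose R ** transpose R) = trace (R ** R)"
    by (metis matrix_transpose_mul trace_transpose)
  then have "(norm (R - transpose R))\<^sup>2 = 2 * defect (R ** R)"
    unfolding power2_norm_eq_inner inner_matrix_eq_trace transpose_diff matrix_distribs trace_distribs
      transpose_transpose SO_orthogonal[OF R]
    by (simp add: trace_I defect_def)
  then have "norm (R - transpose R) = sqrt 2 * sqrt (defect (R ** R))"
    by (metis norm_ge_zero real_sqrt_mult real_sqrt_unique)
  moreover have "- 2 * trace (W ** R) \<le> norm W * norm (R - transpose R)"
    using 2 norm_cauchy_schwarz[of W "R - transpose R"] by simp
  ultimately have "- trace (W ** R) \<le> norm W * (sqrt 2 * sqrt (defect (R ** R))) / 2"
    by simp
  also have "\<dots> = mat_norm W * sqrt (defect (R ** R))"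
    by (simp add: mat_norm_eq_norm field_simps)
  finally show ?thesis .
qed

text \<open>The left side is the time derivative of the defect. With
  \<open>w = sqrt (defect (R ** R))\<close> it is at most \<open>- k * w * (w / 2 - a)\<close>, and
  \<open>b\<close> is chosen below \<open>w / 2\<close>.\<close>

lemma winfree_defect_decay:
  fixes W R :: "real^'n^'n"
  assumes W: "W \<in> so" and R: "R \<in> SO" and k: "0 < k" "k / 2 \<le> s"
    and a: "mat_norm W = k * a" "a < b" "0 \<le> a" and b: "4 * b\<^sup>2 \<le> defect R * (4 - defect R)"
  shows "- trace (W ** R + s *\<^sub>R (mat 1 - R ** R)) \<le> - (2 * k * b * (b - a))"
proof -
  define w where "w = sqrt (defect (R ** R))"
  have D: "0 \<le> defect (R ** R)" using R by (intro defect_nonneg SO_mult)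
  have "(2 * b)\<^sup>2 \<le> defect (R ** R)"
    using b defect_square_ge[OF R] by (simp add: power_mult_distrib)
  then have w: "2 * b \<le> w" unfolding w_def by (rule real_le_rsqrt)
  have w2: "defect (R ** R) = w * w" using D by (simp add: w_def)
  have "- trace (W ** R + s *\<^sub>R (mat 1 - R ** R)) = - trace (W ** R) - s * defect (R ** R)"
    by (simp add: trace_distribs trace_I defect_def)
  also have "\<dots> \<le> k * a * w - k / 2 * (w * w)"
    using trace_skew_rotation_le[OF W R] mult_right_mono[OF k(2) D]
    unfolding a(1) w_def[symmetric] by (simp add: w2)
  also have "\<dots> = - (k * (w * (w / 2 - a)))" by (simp add: algebra_simps)
  also have "\<dots> \<le> - (k * (2 * b * (b - a)))"
    using w a k by (intro le_imp_neg_le mult_left_mono mult_mono) auto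
  finally show ?thesis by (simp add: mult_ac)
qed

text \<open>As \<beta> is a limit of points where \<open>It\<close> is nonzero, one of them lies
  beyond \<gamma>, and monotonicity carries positivity back to \<gamma>. A positive \<beta> in the
  domain also forces dimension at least 2.\<close>

lemma influence_profile_lower_bound:
  assumes prof: "influence_profile n \<beta> It" and "0 < \<beta>" "0 \<le> \<gamma>" "\<gamma> < \<beta>"
  shows "1 \<le> n div 2" "0 < It \<gamma>"
    "0 \<le> r \<Longrightarrow> r \<le> real (n div 2) * pi \<Longrightarrow> 0 \<le> It r" "0 \<le> r \<Longrightarrow> r \<le> \<gamma> \<Longrightarrow> It \<gamma> \<le> It r"
proof -
  define D where "D = {0..real (n div 2) * pi}"
  have nonneg: "\<And>r. r \<in> D \<Longrightarrow> 0 \<le> It r" and anti: "antimono_on D It"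
    and cl: "closure {r\<in>D. It r \<noteq> 0} = {0..\<beta>}"
    using prof unfolding influence_profile_def Let_def D_def[symmetric] by blast+
  have bcl: "\<beta> \<in> closure {r\<in>D. It r \<noteq> 0}" using cl \<open>0 < \<beta>\<close> by simp
  then have "\<beta> \<in> closure D" by (rule subsetD[OF closure_mono, rotated]) blast
  then have bD: "\<beta> \<in> D" by (simp add: D_def)
  show "1 \<le> n div 2" using bD \<open>0 < \<beta>\<close> by (cases "n div 2 = 0") (auto simp: D_def)
  obtain r where r: "r \<in> D" "It r \<noteq> 0" "dist r \<beta> < \<beta> - \<gamma>"
    using bcl \<open>\<gamma> < \<beta>\<close> unfolding closure_approachable by (metis (mono_tags, lifting) diff_gt_0_iff_gt mem_Collect_eq)
  then have "\<gamma> < r" by (simp add: dist_real_def)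
  have gD: "\<gamma> \<in> D" using bD assms by (simp add: D_def)
  have "It r \<le> It \<gamma>" using anti r(1) \<open>\<gamma> < r\<close> gD by (auto simp: monotone_on_def)
  then show "0 < It \<gamma>" using nonneg[OF r(1)] r(2) by simp
  show "0 \<le> It r" if "0 \<le> r" "r \<le> real (n div 2) * pi" for r
    using that nonneg by (simp add: D_def)
  show "It \<gamma> \<le> It r" if "0 \<le> r" "r \<le> \<gamma>" for r
    using anti gD that by (auto simp: monotone_on_def D_def)
qed

text \<open>If every \<open>\<Omega> j\<close> vanishes, the limit radius is 0 and no limit superior
  of distances lies strictly below it; in that case the non-strict bound expresses convergence to
  the identity.\<close>

theorem corollary3p1:
  fixes N :: nat
    and \<Omega> R0 :: "nat \<Rightarrow> real^'n^'n"
    and R :: "nat \<Rightarrow> real \<Rightarrow> real^'n^'n"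
    and It :: "real \<Rightarrow> real"
    and \<kappa> \<beta> \<gamma>0 \<gamma> :: real
  assumes Omega: "\<forall>i\<in>{1..N}. \<Omega> i \<in> so"
    and kappa_pos: "\<kappa> > 0"
    and init: "\<forall>i\<in>{1..N}. R0 i \<in> SO"
    and profile: "influence_profile CARD('n) \<beta> It"
    and beta: "0 < \<beta>" "\<beta> < pi / 2"
    and gamma0: "0 < \<gamma>0" "\<gamma>0 < 2 * sin (\<beta> / 2)"
    and gamma: "\<gamma> = 2 * arcsin (\<gamma>0 / 2)" "\<gamma> < \<beta>"
    and index: "\<exists>i\<in>{1..N}. R0 i \<in> SO_ball \<gamma>0"
    and coupling: "\<kappa> > kappa_c N \<Omega> It \<gamma>"
    and init_ball: "\<forall>i\<in>{1..N}. R0 i \<in> SO_ball (Gamma_radius N \<Omega> \<kappa> It \<gamma> i)"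
    and solution: "winfree_solution N \<Omega> \<kappa> It R0 R"
  shows "\<forall>i\<in>{1..N}.
     (if \<forall>j\<in>{1..N}. \<Omega> j = 0
      then Limsup at_top (\<lambda>t. ereal (SO_dist (mat 1) (R i t))) \<le> ereal (limit_radius N \<Omega> \<kappa> It \<gamma>)
      else Limsup at_top (\<lambda>t. ereal (SO_dist (mat 1) (R i t))) < ereal (limit_radius N \<Omega> \<kappa> It \<gamma>))
     \<and> limit_radius N \<Omega> \<kappa> It \<gamma> < \<gamma>"
proof -

  \<comment> \<open>The defects, the largest frequency and the distinguished oscillator\<close>
  define V where "V i t = defect (R i t)" for i t
  define M where "M = Max ((\<lambda>j. mat_norm (\<Omega> j)) ` {1..N})"
  obtain l where l: "l \<in> {1..N}" and l_ball: "R0 l \<in> SO_ball \<gamma>0" using index by blast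
  have N: "0 < real N" using l by simp
  have M_ge: "mat_norm (\<Omega> i) \<le> M" if "i \<in> {1..N}" for i
    unfolding M_def using that by (intro Max_ge) auto
  have "M \<in> (\<lambda>j. mat_norm (\<Omega> j)) ` {1..N}"
    unfolding M_def using l by (intro Max_in) auto
  then obtain jmax where jmax: "jmax \<in> {1..N}" "M = mat_norm (\<Omega> jmax)" by blast
  have M0: "0 \<le> M" by (simp add: jmax(2) mat_norm_nonneg)

  \<comment> \<open>Bounds on the angle \<gamma> and its chord \<open>\<gamma>0\<close>\<close>
  have "\<gamma>0 < \<beta>" using gamma0(2) sin_x_le_x[of "\<beta> / 2"] beta by simp
  with beta have g0_pi2: "\<gamma>0 < pi / 2" by simp
  \<comment> \<open>An angle below a right angle has squared chord below 2, so the level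
    \<open>\<gamma>0^2\<close> lies below the vertex of \<open>x * (4 - x)\<close>.\<close>
  have "cos \<beta> = 1 - 2 * (sin (\<beta> / 2))\<^sup>2" using cos_double_sin[of "\<beta> / 2"] by simp
  moreover have "0 < cos \<beta>" using beta by (intro cos_gt_zero) auto
  moreover have "\<gamma>0\<^sup>2 < (2 * sin (\<beta> / 2))\<^sup>2" using gamma0 by (intro power_strict_mono) auto
  ultimately have g0_2: "\<gamma>0\<^sup>2 < 2" unfolding power_mult_distrib by simp
  then have "\<gamma>0\<^sup>2 < 2\<^sup>2" by simp
  then have g0_lt2: "\<gamma>0 < 2" by (rule power_less_imp_less_base) simp
  have half: "sin (\<gamma> / 2) = \<gamma>0 / 2" using gamma0 g0_lt2 gamma(1) by simp
  then have chord: "2 * sin (\<gamma> / 2) = \<gamma>0" by simp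
  have g_pos: "0 < \<gamma>" using gamma(1) gamma0 g0_lt2 arcsin_less_arcsin[of 0 "\<gamma>0 / 2"] by simp
  have g_pi2: "\<gamma> < pi / 2" using gamma(2) beta(2) by simp
  have g0_le: "\<gamma>0 \<le> \<gamma>" using sin_x_le_x[of "\<gamma> / 2"] g_pos half by simp

  \<comment> \<open>Normalised frequencies and the limit radius\<close>
  note prof = influence_profile_lower_bound[OF profile beta(1) less_imp_le[OF g_pos] gamma(2)]
  \<comment> \<open>\<open>k / 2\<close> is the coupling strength that oscillator \<open>l\<close>
    alone guarantees while within distance \<gamma> of the identity; \<open>a\<close> and
    \<open>A\<close> are frequencies in units of \<open>k\<close>.\<close>
  define k where "k = \<kappa> * It \<gamma> / real N"
  have k: "0 < k" using kappa_pos prof(2) N by (simp add: k_def)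
  define a where "a i = mat_norm (\<Omega> i) / k" for i
  define A where "A = M / k"
  have a: "mat_norm (\<Omega> i) = k * a i" "0 \<le> a i" for i
    using k by (simp_all add: a_def mat_norm_nonneg)
  have aA: "a i \<le> A" if "i \<in> {1..N}" for i
    using M_ge[OF that] k by (simp add: a_def A_def divide_right_mono)
  have A0: "0 \<le> A" using M0 k by (simp add: A_def)
  have sin_g0: "0 < sin \<gamma>0" using gamma0 g0_pi2 by (intro sin_gt_zero) auto
  have kc: "kappa_c N \<Omega> It \<gamma> = real N * M / (sin \<gamma>0 * It \<gamma>)"
    unfolding kappa_c_def chord M_def ..
  have "kappa_c N \<Omega> It \<gamma> / \<kappa> * sin \<gamma>0 = A"
    unfolding kc A_def k_def using sin_g0 prof(2) kappa_pos N by (simp add: field_simps)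
  then have lim: "limit_radius N \<Omega> \<kappa> It \<gamma> = 2 * arcsin (arcsin A / 2)"
    unfolding limit_radius_def chord by simp
  have A_lt: "A < sin \<gamma>0"
  proof -
    have "real N * M < \<kappa> * (sin \<gamma>0 * It \<gamma>)"
      using coupling sin_g0 prof(2) unfolding kc by (simp add: pos_divide_less_eq)
    then show ?thesis unfolding A_def k_def using kappa_pos prof(2) N by (simp add: field_simps)
  qed
  then have A1: "A < 1" using sin_le_one[of \<gamma>0] by linarith
  define \<alpha> where "\<alpha> = arcsin A"
  have sin_al: "sin \<alpha> = A" unfolding \<alpha>_def using A0 A1 by simp
  have al0: "0 \<le> \<alpha>" unfolding \<alpha>_def using A0 A1 by (intro arcsin_nonneg) simp
  have "arcsin A < arcsin (sin \<gamma>0)" using A0 A_lt by (intro arcsin_less_arcsin) auto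
  then have al_lt: "\<alpha> < \<gamma>0" using g0_pi2 gamma0(1) by (simp add: \<alpha>_def arcsin_sin)
  have lim_lt: "limit_radius N \<Omega> \<kappa> It \<gamma> < \<gamma>"
    using arcsin_less_arcsin[of "\<alpha> / 2" "\<gamma>0 / 2"] al_lt al0 g0_lt2 lim gamma(1)
    unfolding \<alpha>_def by linarith

  \<comment> \<open>Where the coupling dominates the frequencies\<close>
  have sin_mono_A: "A < sin m" if "\<alpha> < m" "m \<le> pi / 2" for m
    using sin_monotone_2pi[of \<alpha> m] that al0 unfolding sin_al by simp
  have g0_quad: "4 * A\<^sup>2 < \<gamma>0\<^sup>2 * (4 - \<gamma>0\<^sup>2)"
  proof -
    have "A < sin \<gamma>" using al_lt g0_le g_pi2 by (intro sin_mono_A) auto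
    then have "A\<^sup>2 < (sin \<gamma>)\<^sup>2" using A0 by (intro power_strict_mono) auto
    then show ?thesis using chord_quadratic_sin[of \<gamma>] unfolding chord by simp
  qed
  \<comment> \<open>The larger root of \<open>x * (4 - x) = 4 * (a i)^2\<close>, and the square of
    the radius \<Gamma>_i.\<close>
  define G where "G i = 2 + 2 * sqrt (1 - (a i)\<^sup>2)" for i
  have a2: "(a i)\<^sup>2 \<le> A\<^sup>2" "A\<^sup>2 < 1" if "i \<in> {1..N}" for i
    using aA[OF that] a(2)[of i] A0 A1 by (auto intro!: power_mono simp: power_less_one_iff abs_square_less_1)
  have barrier_quad: "4 * (a i)\<^sup>2 < c * (4 - c)"
    if i: "i \<in> {1..N}" and c: "\<gamma>0\<^sup>2 \<le> c" "c < G i" for i c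
  proof -
    define q where "q = 2 * sqrt (1 - (a i)\<^sup>2)"
    have q0: "0 \<le> q" and q2: "q\<^sup>2 = 4 * (1 - (a i)\<^sup>2)"
      using a2[OF i] by (simp_all add: q_def power_mult_distrib)
    have "(2 - \<gamma>0\<^sup>2)\<^sup>2 = 4 - \<gamma>0\<^sup>2 * (4 - \<gamma>0\<^sup>2)" by (simp add: power2_eq_square algebra_simps)
    then have "(2 - \<gamma>0\<^sup>2)\<^sup>2 < q\<^sup>2" using g0_quad a2(1)[OF i] by (simp add: q2)
    then have "2 - \<gamma>0\<^sup>2 < q" using q0 by (rule power2_less_imp_less)
    then have "\<bar>c - 2\<bar> < q" using c unfolding G_def q_def[symmetric] by linarith
    then have "(c - 2)\<^sup>2 < 4 * (1 - (a i)\<^sup>2)"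
      unfolding q2[symmetric] by (metis abs_ge_zero power2_abs power_strict_mono zero_less_numeral)
    moreover have "(c - 2)\<^sup>2 = 4 - c * (4 - c)" by (simp add: power2_eq_square algebra_simps)
    ultimately show ?thesis by (simp add: algebra_simps)
  qed
  have Gamma: "Gamma_radius N \<Omega> \<kappa> It \<gamma> i = sqrt (G i)" for i
  proof -
    have "(real N)\<^sup>2 * (mat_norm (\<Omega> i))\<^sup>2 / (\<kappa>\<^sup>2 * (It \<gamma>)\<^sup>2) = (a i)\<^sup>2"
      using kappa_pos prof(2) N by (simp add: a_def k_def power_divide power_mult_distrib)
    then show ?thesis by (simp add: Gamma_radius_def G_def)
  qed

  \<comment> \<open>The defect along the solution\<close>
  have sol: "R i 0 = R0 i" "continuous_on {0..} (R i)" "\<And>t. 0 \<le> t \<Longrightarrow> R i t \<in> SO" if "i \<in> {1..N}" for i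
    using solution that by (auto simp: winfree_solution_def)
  define S where "S t = \<kappa> / 2 * ((1 / real N) * (\<Sum>j=1..N. influence It (R j t)))" for t
  have ode: "(R i has_vector_derivative (\<Omega> i ** R i t + S t *\<^sub>R (mat 1 - R i t ** R i t))) (at t)"
    if "i \<in> {1..N}" "0 < t" for i t
    using solution that by (auto simp: winfree_solution_def S_def)
  have V0: "0 \<le> V i t" if "i \<in> {1..N}" "0 \<le> t" for i t
    unfolding V_def using that by (intro defect_nonneg sol)
  have contV: "continuous_on {0..} (V i)" if "i \<in> {1..N}" for i
    unfolding V_def defect_def
    by (intro continuous_intros bounded_linear.continuous_on[OF bounded_linear_trace] sol that)
  have derV: "(V i has_real_derivative
      - trace (\<Omega> i ** R i t + S t *\<^sub>R (mat 1 - R i t ** R i t))) (at t)"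
    if "i \<in> {1..N}" "0 < t" for i t
    unfolding V_def defect_def has_real_derivative_iff_has_vector_derivative
    by (auto intro!: derivative_eq_intros bounded_linear.has_vector_derivative[OF bounded_linear_trace ode] that)
  have dist_V: "SO_dist (mat 1) (R i t) \<le> 2 * arcsin (sqrt (V i t) / 2)" "0 \<le> SO_dist (mat 1) (R i t)"
    if "i \<in> {1..N}" "0 \<le> t" "V i t < 4" for i t
    using SO_dist_le_arcsin[OF sol(3)[OF that(1,2)]] sqrt_defect_le_SO_dist[OF sol(3)[OF that(1,2)]]
      that(3) V0[OF that(1,2)] unfolding V_def
    by (auto intro: order_trans[OF real_sqrt_ge_zero])
  have V_init: "V i 0 < r\<^sup>2" if "i \<in> {1..N}" "R0 i \<in> SO_ball r" for i r
  proof -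
    have "sqrt (V i 0) < r"
      using sqrt_defect_le_SO_dist[OF sol(3)[OF that(1), of 0]] that(2)
      by (simp add: V_def sol(1)[OF that(1)] SO_ball_def)
    then have "(sqrt (V i 0))\<^sup>2 < r\<^sup>2"
      using V0[OF that(1)] by (intro power_strict_mono) auto
    then show ?thesis using V0[OF that(1)] by simp
  qed

  \<comment> \<open>Barrier levels\<close>
  \<comment> \<open>Oscillators starting below \<open>\<gamma>0^2\<close>, among them
    \<open>l\<close>, receive that level, so \<open>l\<close> keeps its influence; the others
    receive a level strictly between their initial defect and the larger root.\<close>
  define c where "c i = (if V i 0 < \<gamma>0\<^sup>2 then \<gamma>0\<^sup>2 else (V i 0 + G i) / 2)" for i
  have c: "V i 0 < c i" "\<gamma>0\<^sup>2 \<le> c i" "c i < G i" if i: "i \<in> {1..N}" for i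
  proof -
    have "0 \<le> 1 - (a i)\<^sup>2" using a2[OF i] by simp
    then have "2 \<le> G i" by (simp add: G_def)
    moreover have "V i 0 < G i"
      using V_init[OF i, of "sqrt (G i)"] init_ball i \<open>2 \<le> G i\<close> unfolding Gamma by simp
    ultimately show "V i 0 < c i" "\<gamma>0\<^sup>2 \<le> c i" "c i < G i"
      using g0_2 by (auto simp: c_def)
  qed
  have cl: "c l = \<gamma>0\<^sup>2" using V_init[OF l l_ball] by (simp add: c_def)
  have c4: "c i < 4" if "i \<in> {1..N}" for i
  proof -
    have "0 < c i * (4 - c i)"
      using barrier_quad[OF that c(2,3)[OF that]] zero_le_power2[of "a i"] by linarith
    moreover have "0 < c i" using c(2)[OF that] gamma0(1) by (meson less_le_trans zero_less_power)
    ultimately show ?thesis by (simp add: zero_less_mult_iff)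
  qed

  \<comment> \<open>Lower bound for the coupling strength\<close>
  have S_ge: "k / 2 \<le> S t" if t: "0 \<le> t" and V_le: "\<forall>j\<in>{1..N}. V j t \<le> c j" for t
  proof -
    \<comment> \<open>The profile is constrained only on its domain. Defects below 4 keep the
      distances at most \<open>pi\<close>, which lies in the domain because the dimension is at
      least 2.\<close>
    have nonneg: "0 \<le> influence It (R j t)" if j: "j \<in> {1..N}" for j
    proof -
      have V4: "V j t < 4" using V_le j c4[OF j] by force
      have "sqrt (V j t) / 2 \<le> 1" using real_sqrt_le_mono[of "V j t" 4] V4 by simp
      moreover have "- 1 \<le> sqrt (V j t) / 2" using real_sqrt_ge_zero[OF V0[OF j t]] by linarith
      ultimately have "SO_dist (mat 1) (R j t) \<le> 1 * pi"
        using dist_V(1)[OF j t V4] arcsin_ubound[of "sqrt (V j t) / 2"] by linarith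
      also have "\<dots> \<le> real (CARD('n) div 2) * pi"
        using prof(1) by (intro mult_right_mono) (auto simp: of_nat_le_iff[of 1, simplified])
      finally show ?thesis
        unfolding influence_def using prof(3) dist_V(2)[OF j t V4] by blast
    qed
    have V4: "V l t < 4" using V_le l c4[OF l] by force
    have "sqrt (V l t) \<le> \<gamma>0"
      using bspec[OF V_le l] gamma0(1) by (intro real_le_lsqrt) (simp_all add: cl)
    then have "arcsin (sqrt (V l t) / 2) \<le> arcsin (\<gamma>0 / 2)"
      using real_sqrt_ge_zero[OF V0[OF l t]] g0_lt2 by (intro arcsin_le_arcsin; linarith)
    then have "SO_dist (mat 1) (R l t) \<le> \<gamma>"
      using dist_V(1)[OF l t V4] unfolding gamma(1) by linarith
    then have "It \<gamma> \<le> influence It (R l t)"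
      unfolding influence_def using prof(4) dist_V(2)[OF l t V4] by blast
    also have "\<dots> \<le> (\<Sum>j=1..N. influence It (R j t))"
      using l nonneg by (intro member_le_sum) auto
    finally have "\<kappa> / 2 * ((1 / real N) * It \<gamma>) \<le> S t"
      unfolding S_def using kappa_pos by (intro mult_left_mono) auto
    then show ?thesis by (simp add: k_def)
  qed

  \<comment> \<open>Decay rates and invariance of the barriers\<close>
  have decay: "- trace (\<Omega> i ** R i t + S t *\<^sub>R (mat 1 - R i t ** R i t)) \<le> - (2 * k * b * (b - a i))"
    if "i \<in> {1..N}" "0 \<le> t" "\<forall>j\<in>{1..N}. V j t \<le> c j" "a i < b" "4 * b\<^sup>2 \<le> V i t * (4 - V i t)" for i t b
    using winfree_defect_decay[OF _ sol(3)[OF that(1,2)] k S_ge[OF that(2,3)] a(1) that(4) a(2)] that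
      Omega by (simp add: V_def)
  have rate_pos: "0 < 2 * k * b * (b - a i)" if "a i < b" for i b
    using k a(2)[of i] that by simp

  have below: "V i t < c i" if "i \<in> {1..N}" "0 \<le> t" for i t
  proof (rule first_exit_barrier[of "{1..N}" V c, OF _ contV c(1) _ that])
    fix i t assume i: "i \<in> {1..N}" and t: "0 < t" and V_le: "\<forall>j\<in>{1..N}. V j t \<le> c j"
      and eq: "V i t = c i"
    \<comment> \<open>The value for which \<open>4 * b^2\<close> equals
      \<open>c i * (4 - c i)\<close> on the barrier.\<close>
    define b where "b = sqrt (c i * (4 - c i)) / 2"
    have quad: "4 * (a i)\<^sup>2 < c i * (4 - c i)" by (rule barrier_quad[OF i c(2,3)[OF i]])
    then have "2 * a i < sqrt (c i * (4 - c i))"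
      by (intro real_less_rsqrt) (simp add: power_mult_distrib)
    then have b: "a i < b" by (simp add: b_def)
    have "0 \<le> c i * (4 - c i)" using quad zero_le_power2[of "a i"] by linarith
    then have "4 * b\<^sup>2 \<le> V i t * (4 - V i t)" by (simp add: b_def power_divide eq)
    from decay[OF i _ V_le b this] t have
      "- trace (\<Omega> i ** R i t + S t *\<^sub>R (mat 1 - R i t ** R i t)) < 0"
      using rate_pos[OF b] by linarith
    then show "\<exists>y<0. (V i has_real_derivative y) (at t)" using derV[OF i t] by blast
  qed simp_all

  \<comment> \<open>Eventual bounds on the distances\<close>
  have ev: "\<forall>\<^sub>F t in at_top. SO_dist (mat 1) (R i t) \<le> m"
    if i: "i \<in> {1..N}" and m: "\<alpha> < m" "m \<le> pi / 2" for i m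
  proof -
    define L where "L = (2 * sin (m / 2))\<^sup>2"
    \<comment> \<open>The minimum makes \<open>4 * b^2\<close> a lower bound of
      \<open>x * (4 - x)\<close> at both \<open>L\<close> and \<open>c i\<close>, hence by concavity
      on the whole range of the defect above \<open>L\<close>.\<close>
    define b where "b = min (sin m) (sqrt (c i * (4 - c i)) / 2)"
    have quad: "4 * (a i)\<^sup>2 < c i * (4 - c i)" by (rule barrier_quad[OF i c(2,3)[OF i]])
    then have "2 * a i < sqrt (c i * (4 - c i))"
      by (intro real_less_rsqrt) (simp add: power_mult_distrib)
    then have b: "a i < b" using sin_mono_A[OF m] aA[OF i] by (simp add: b_def)
    then have b0: "0 \<le> b" using a(2)[of i] by simp
    have "b\<^sup>2 \<le> (sin m)\<^sup>2" using b0 by (intro power_mono) (auto simp: b_def)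
    then have bL: "4 * b\<^sup>2 \<le> L * (4 - L)" unfolding L_def chord_quadratic_sin by simp
    have "0 \<le> c i * (4 - c i)" using quad zero_le_power2[of "a i"] by linarith
    moreover have "b\<^sup>2 \<le> (sqrt (c i * (4 - c i)) / 2)\<^sup>2" using b0 by (intro power_mono) (auto simp: b_def)
    ultimately have bc: "4 * b\<^sup>2 \<le> c i * (4 - c i)" by (simp add: power_divide)
    have "\<forall>\<^sub>F t in at_top. V i t < L"
    proof (rule eventually_below_level[OF contV[OF i] V0[OF i] rate_pos[OF b]])
      fix t :: real assume t: "0 < t" "L \<le> V i t"
      have le: "\<forall>j\<in>{1..N}. V j t \<le> c j" using below t by (simp add: less_imp_le)
      have "4 * b\<^sup>2 \<le> V i t * (4 - V i t)"
        using t(2) bspec[OF le i] bL bc by (rule quadratic_lower_bound)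
      then show "\<exists>y\<le>- (2 * k * b * (b - a i)). (V i has_real_derivative y) (at t)"
        using decay[OF i less_imp_le[OF t(1)] le b] derV[OF i t(1)] by blast
    qed
    then show ?thesis
      using eventually_ge_at_top[of 0]
    proof eventually_elim
      case (elim t)
      have s0: "0 \<le> sin (m / 2)" using al0 m by (intro sin_ge_zero) auto
      have V4: "V i t < 4" using below[OF i elim(2)] c4[OF i] by simp
      have "sqrt (V i t) \<le> 2 * sin (m / 2)"
        using elim(1) s0 by (intro real_le_lsqrt) (auto simp: L_def)
      then have "arcsin (sqrt (V i t) / 2) \<le> arcsin (sin (m / 2))"
        using real_sqrt_ge_zero[OF V0[OF i elim(2)]] sin_le_one[of "m / 2"]
        by (intro arcsin_le_arcsin; linarith)
      also have "\<dots> = m / 2" using al0 m by (intro arcsin_sin) auto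
      finally show ?case using dist_V(1)[OF i elim(2) V4] by linarith
    qed
  qed
  have Limsup_le: "Limsup at_top (\<lambda>t. ereal (SO_dist (mat 1) (R i t))) \<le> ereal m"
    if "i \<in> {1..N}" "\<alpha> < m" "m \<le> pi / 2" for i m
    using ev[OF that] by (intro Limsup_bounded) simp

  \<comment> \<open>Limit superior\<close>
  show ?thesis
  proof (intro ballI conjI lim_lt)
    fix i assume i: "i \<in> {1..N}"
    show "if \<forall>j\<in>{1..N}. \<Omega> j = 0
      then Limsup at_top (\<lambda>t. ereal (SO_dist (mat 1) (R i t))) \<le> ereal (limit_radius N \<Omega> \<kappa> It \<gamma>)
      else Limsup at_top (\<lambda>t. ereal (SO_dist (mat 1) (R i t))) < ereal (limit_radius N \<Omega> \<kappa> It \<gamma>)"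
    proof (cases "\<forall>j\<in>{1..N}. \<Omega> j = 0")
      case True
      then have "M = 0" using jmax by (simp add: mat_norm_eq_norm)
      then have zero: "\<alpha> = 0" "limit_radius N \<Omega> \<kappa> It \<gamma> = 0"
        by (simp_all add: \<alpha>_def A_def lim)
      have "Limsup at_top (\<lambda>t. ereal (SO_dist (mat 1) (R i t))) \<le> 0"
      proof (rule dense_ge_bounded[of _ "ereal (pi / 2)"])
        fix w :: ereal assume w: "0 < w" "w < ereal (pi / 2)"
        then obtain m where "w = ereal m" by (cases w) auto
        then show "Limsup at_top (\<lambda>t. ereal (SO_dist (mat 1) (R i t))) \<le> w"
          using Limsup_le[OF i, of m] w zero by simp
      qed simp
      then show ?thesis using True zero by (simp add: zero_ereal_def)
    next
      case False
      then obtain j where j: "j \<in> {1..N}" "\<Omega> j \<noteq> 0" by blast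
      then have "0 < mat_norm (\<Omega> j)" by (simp add: mat_norm_eq_norm)
      then have "0 < A" using M_ge[OF j(1)] k by (simp add: A_def)
      then have al_pos: "0 < \<alpha>" unfolding \<alpha>_def using A1 arcsin_less_arcsin[of 0 A] by simp
      \<comment> \<open>The eventual bounds come arbitrarily close to \<alpha>, whereas the limit
        radius is \<open>2 * \<rho>\<close> with \<open>sin \<rho> = \<alpha> / 2\<close>.
        Strictness comes from \<open>sin \<rho> < \<rho>\<close>.\<close>
      define \<rho> where "\<rho> = arcsin (\<alpha> / 2)"
      have a2: "\<alpha> / 2 < 1" using al_lt g0_lt2 by simp
      have "0 < \<rho>" unfolding \<rho>_def using al_pos a2 arcsin_less_arcsin[of 0 "\<alpha> / 2"] by simp
      moreover have "\<rho> \<le> pi" unfolding \<rho>_def using al_pos a2 arcsin_ubound[of "\<alpha> / 2"] pi_gt_zero by linarith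
      ultimately have "sin \<rho> < \<rho>" by (rule sin_less_self)
      moreover have "sin \<rho> = \<alpha> / 2" unfolding \<rho>_def using al_pos a2 by simp
      ultimately have "\<alpha> < 2 * \<rho>" by simp
      then obtain m where m: "\<alpha> < m" "m < 2 * \<rho>" using dense by blast
      have lr: "limit_radius N \<Omega> \<kappa> It \<gamma> = 2 * \<rho>" by (simp add: lim \<rho>_def \<alpha>_def)
      have "Limsup at_top (\<lambda>t. ereal (SO_dist (mat 1) (R i t))) \<le> ereal m"
        using m lim_lt g_pi2 lr by (intro Limsup_le[OF i]) auto
      also have "\<dots> < ereal (2 * \<rho>)" using m by simp
      finally show ?thesis unfolding if_not_P[OF False] lr .
    qed
  qed
qed

end
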